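(* Let $s\in\mathbb R$ and $\varphi\in L^2(\mathbb R^d,d\gamma)$, and assume that for some $a,b>0$, $$\|e^{a|\cdot|^2}\varphi\|_{L^2(\mathbb R^d,d\gamma)}+\|e^{b|\cdot|^2}e^{is\mathscr L}\varphi\|_{L^2(\mathbb R^d,d\gamma)}<\infty .$$ If $ab\sin^2s\ge\frac1{16}$, then $\varphi\equiv0$.
   Context: $d\gamma(x)=(2\pi)^{-d/2}e^{-|x|^2/2}dx$ on $\mathbb R^d$ and $\mathscr L=\Delta-\langle x,\nabla\rangle$ with its natural self-adjoint realization in $L^2(\mathbb R^d,d\gamma)$ (the Hermite polynomials $H_\alpha$ form a complete orthogonal system with $\mathscr L H_\alpha=-|\alpha|H_\alpha$); $\{e^{it\mathscr L}\}_{t\in\mathbb R}$ is the associated unitary group on $L^2(\mathbb R^d,d\gamma)$. *)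

theory Defs
  imports "HOL-Analysis.Analysis" "HOL-Computational_Algebra.Polynomial"
begin

definition gaussian :: "(real ^ 'd) measure" where
  "gaussian = density lborel
     (\<lambda>x. ennreal ((2 * pi) powr (- real CARD('d) / 2) * exp (- (norm x)\<^sup>2 / 2)))"

text \<open>Elements of \<open>L2 M\<close> are representatives: the elements of the Hilbert space are their
  classes modulo equality almost everywhere.\<close>

definition L2 :: "'a measure \<Rightarrow> ('a \<Rightarrow> complex) set" where
  "L2 M = {f \<in> borel_measurable M. integrable M (\<lambda>x. (cmod (f x))\<^sup>2)}"

definition L2_inner :: "'a measure \<Rightarrow> ('a \<Rightarrow> complex) \<Rightarrow> ('a \<Rightarrow> complex) \<Rightarrow> complex" where
  "L2_inner M f g = (LINT x|M. f x * cnj (g x))"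


section \<open>The differential expression\<close>

definition partial :: "'d \<Rightarrow> (real ^ 'd \<Rightarrow> complex) \<Rightarrow> real ^ 'd \<Rightarrow> complex" where
  "partial i f x = vector_derivative (\<lambda>t. f (x + t *\<^sub>R axis i 1)) (at 0)"

definition ou_expr :: "(real ^ 'd \<Rightarrow> complex) \<Rightarrow> real ^ 'd \<Rightarrow> complex" where
  "ou_expr f x = (\<Sum>i\<in>UNIV. partial i (partial i f) x) - (\<Sum>i\<in>UNIV. of_real (x $ i) * partial i f x)"


section \<open>Hermite polynomials\<close>

text \<open>The recursion is Rodrigues' formula
  \<open>He n x = (-1)^n * exp (x^2/2) * (d/dx)^n exp (-x^2/2)\<close>, the normalization orthogonal
  for the standard Gaussian weight.\<close>

fun hermite_poly :: "nat \<Rightarrow> real poly" where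
  "hermite_poly 0 = 1"
| "hermite_poly (Suc n) = [:0, 1:] * hermite_poly n - pderiv (hermite_poly n)"

definition hermite :: "('d::finite \<Rightarrow> nat) \<Rightarrow> real ^ 'd \<Rightarrow> complex" where
  "hermite \<alpha> x = of_real (\<Prod>i\<in>UNIV. poly (hermite_poly (\<alpha> i)) (x $ i))"

definition multi_degree :: "('d::finite \<Rightarrow> nat) \<Rightarrow> nat" where
  "multi_degree \<alpha> = (\<Sum>i\<in>UNIV. \<alpha> i)"

lemma pderiv_hermite_poly:
  "pderiv (hermite_poly (Suc n)) = smult (real (Suc n)) (hermite_poly n)"
proof (induction n)
  case (Suc n)
  have "pderiv (hermite_poly (Suc (Suc n))) =
      hermite_poly (Suc n) + [:0, 1:] * pderiv (hermite_poly (Suc n))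
        - pderiv (pderiv (hermite_poly (Suc n)))"
    unfolding hermite_poly.simps(2)[of "Suc n"]
    by (simp only: pderiv_diff pderiv_mult) (simp add: pderiv_pCons)
  also have "\<dots> = hermite_poly (Suc n)
      + smult (real (Suc n)) ([:0, 1:] * hermite_poly n - pderiv (hermite_poly n))"
    unfolding Suc.IH pderiv_smult by (simp only: mult_smult_right smult_diff_right add_diff_eq)
  also have "\<dots> = hermite_poly (Suc n) + smult (real (Suc n)) (hermite_poly (Suc n))"
    by (simp only: hermite_poly.simps)
  also have "\<dots> = smult (real (Suc (Suc n))) (hermite_poly (Suc n))"
    by (metis add.commute of_nat_Suc smult_1_left smult_add_left)
  finally show ?case .
qed (simp add: pderiv_pCons)

lemma hermite_poly_ode:
  "pderiv (pderiv (hermite_poly n)) - [:0, 1:] * pderiv (hermite_poly n)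
     = smult (- real n) (hermite_poly n)"
proof (cases n)
  case (Suc m)
  have "smult (- real n) (hermite_poly n) = - smult (real n) (hermite_poly n)"
    by simp
  then show ?thesis
    unfolding Suc pderiv_hermite_poly pderiv_smult
    by (simp only: hermite_poly.simps mult_smult_right smult_diff_right)
qed auto

lemma partial_prod_poly:
  fixes p :: "'d::finite \<Rightarrow> real poly"
  shows "partial i (\<lambda>x. complex_of_real (\<Prod>j\<in>UNIV. poly (p j) (x $ j))) =
    (\<lambda>x. complex_of_real (\<Prod>j\<in>UNIV. poly ((p(i := pderiv (p i))) j) (x $ j)))"
proof
  fix x :: "real ^ 'd"
  define C where "C = (\<Prod>j\<in>UNIV - {i}. poly (p j) (x $ j))"
  have "(\<Prod>j\<in>UNIV. poly (p j) ((x + t *\<^sub>R axis i 1) $ j)) = poly (p i) (x $ i + t) * C" for t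
    unfolding C_def by (subst prod.remove[of _ i]) (auto simp: axis_def intro!: prod.cong)
  moreover have "(\<Prod>j\<in>UNIV. poly ((p(i := pderiv (p i))) j) (x $ j)) = poly (pderiv (p i)) (x $ i) * C"
    unfolding C_def by (subst prod.remove[of _ i]) auto
  moreover have "((\<lambda>t. poly (p i) (x $ i + t) * C) has_real_derivative
      poly (pderiv (p i)) (x $ i) * C) (at 0)"
    by (auto intro!: derivative_eq_intros DERIV_chain'[OF _ poly_DERIV])
  then have "((\<lambda>t. complex_of_real (poly (p i) (x $ i + t) * C)) has_vector_derivative
      complex_of_real (poly (pderiv (p i)) (x $ i) * C)) (at 0)"
    by (intro has_vector_derivative_of_real)
       (simp add: has_real_derivative_iff_has_vector_derivative)
  ultimately show "partial i (\<lambda>x. complex_of_real (\<Prod>j\<in>UNIV. poly (p j) (x $ j))) x =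
    complex_of_real (\<Prod>j\<in>UNIV. poly ((p(i := pderiv (p i))) j) (x $ j))"
    unfolding partial_def by (simp only: vector_derivative_at)
qed

lemma ou_expr_hermite:
  "ou_expr (hermite \<alpha>) = (\<lambda>x. - of_nat (multi_degree \<alpha>) * hermite \<alpha> x)"
proof
  fix x
  define p where "p = (\<lambda>i. hermite_poly (\<alpha> i))"
  have h: "hermite \<alpha> = (\<lambda>x. complex_of_real (\<Prod>j\<in>UNIV. poly (p j) (x $ j)))"
    by (auto simp: hermite_def p_def)
  have upd: "(\<Prod>j\<in>UNIV. poly ((p(i := q)) j) (x $ j))
      = poly q (x $ i) * (\<Prod>j\<in>UNIV - {i}. poly (p j) (x $ j))" for i q
    by (subst prod.remove[of _ i]) auto
  have "partial i (partial i (hermite \<alpha>)) x - of_real (x $ i) * partial i (hermite \<alpha>) x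
      = - of_nat (\<alpha> i) * hermite \<alpha> x" for i
  proof -
    have "poly (pderiv (pderiv (p i))) (x $ i) - x $ i * poly (pderiv (p i)) (x $ i)
        = - of_nat (\<alpha> i) * poly (p i) (x $ i)"
      using arg_cong[OF hermite_poly_ode[of "\<alpha> i"], of "\<lambda>q. poly q (x $ i)"]
      by (simp add: p_def)
    moreover define C where "C = (\<Prod>j\<in>UNIV - {i}. poly (p j) (x $ j))"
    ultimately have "poly (pderiv (pderiv (p i))) (x $ i) * C
        - x $ i * (poly (pderiv (p i)) (x $ i) * C) = - of_nat (\<alpha> i) * (poly (p i) (x $ i) * C)"
      by (metis left_diff_distrib mult.assoc)
    then have eq: "complex_of_real (poly (pderiv (pderiv (p i))) (x $ i) * C
        - x $ i * (poly (pderiv (p i)) (x $ i) * C))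
        = complex_of_real (- of_nat (\<alpha> i) * (poly (p i) (x $ i) * C))"
      by (rule arg_cong)
    have "(\<Prod>j\<in>UNIV. poly (p j) (x $ j)) = poly (p i) (x $ i) * C"
      unfolding C_def by (subst prod.remove[of _ i]) auto
    with eq show ?thesis
      unfolding h partial_prod_poly fun_upd_same fun_upd_upd upd C_def[symmetric]
      by simp
  qed
  then show "ou_expr (hermite \<alpha>) x = - of_nat (multi_degree \<alpha>) * hermite \<alpha> x"
    by (simp add: ou_expr_def sum_subtractf[symmetric] multi_degree_def sum_distrib_right
        sum_negf)
qed


section \<open>The self-adjoint realization and its unitary group\<close>

text \<open>Functional calculus of the self-adjoint realization, given by the orthogonal
  decomposition of \<open>L2 gaussian\<close> into the eigenspaces of the Hermite polynomials
  (see \<open>ou_expr_hermite\<close>): \<open>ou_calculus F f g\<close> says that \<open>f\<close> lies in the domain of \<open>F(L)\<close>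
  and that \<open>g\<close> represents \<open>F(L) f\<close>, the series
  \<open>\<Sum>\<alpha>. F (- |\<alpha>|) * (\<langle>f, H \<alpha>\<rangle> / \<langle>H \<alpha>, H \<alpha>\<rangle>) * H \<alpha>\<close>, whose unconditional convergence
  is in the Hilbert space norm.\<close>

definition ou_calculus ::
  "(real \<Rightarrow> complex) \<Rightarrow> (real ^ 'd \<Rightarrow> complex) \<Rightarrow> (real ^ 'd \<Rightarrow> complex) \<Rightarrow> bool" where
  "ou_calculus F f g \<longleftrightarrow> f \<in> L2 gaussian \<and> g \<in> L2 gaussian \<and>
    ((\<lambda>A. \<integral>\<^sup>+x. ennreal ((cmod (g x - (\<Sum>\<alpha>\<in>A. F (- real (multi_degree \<alpha>)) *
        (L2_inner gaussian f (hermite \<alpha>) / L2_inner gaussian (hermite \<alpha>) (hermite \<alpha>)) *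
        hermite \<alpha> x)))\<^sup>2) \<partial>gaussian) \<longlongrightarrow> 0) (finite_subsets_at_top UNIV)"

definition ou_operator :: "(real ^ 'd \<Rightarrow> complex) \<Rightarrow> (real ^ 'd \<Rightarrow> complex) \<Rightarrow> bool" where
  "ou_operator = ou_calculus of_real"

definition ou_group :: "real \<Rightarrow> (real ^ 'd \<Rightarrow> complex) \<Rightarrow> (real ^ 'd \<Rightarrow> complex) \<Rightarrow> bool" where
  "ou_group t = ou_calculus (\<lambda>r. exp (\<i> * of_real t * of_real r))"

end

theory Submission
  imports Defs "HOL-Probability.Probability" "HOL-Real_Asymp.Real_Asymp"
    "HOL-Complex_Analysis.Complex_Analysis"
begin

text \<open>The proof moves the problem to entire functions. The functions \<open>e\<^sub>z x = exp (z \<cdot> x - z \<cdot> z /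
2)\<close>, \<open>z\<close> a complex vector, generate the Hermite polynomials, so the Bargmann transform \<open>B f
z = \<integral> f e\<^sub>z d\<gamma>\<close> has the Hermite coefficients of \<open>f\<close> as its Taylor coefficients. On the
eigenspace of degree \<open>n\<close> the group acts by \<open>exp (- i s n)\<close>, hence it becomes a rotation of
the variable: \<open>B \<psi> z = B \<phi> (exp (- i s) z)\<close> (\<open>ou_group_bargmann\<close>).

Fix a real unit vector \<open>\<omega>\<close> and let \<open>F \<zeta> = B \<phi> (\<zeta> \<omega>)\<close>, an entire function of one complex
variable. By completing the square (\<open>laplace_gaussian_bound\<close>), the decay of \<open>\<phi>\<close> gives \<open>|F \<zeta>|
\<le> C exp (A |\<zeta>|\<^sup>2 + Re ((A - 1/2) \<zeta>\<^sup>2))\<close> with \<open>A = 1 / (2 (4 a + 1))\<close>, and the decay of \<open>\<psi>\<close>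
gives \<open>|F \<zeta>| \<le> C' exp (B |\<zeta>|\<^sup>2 + Re (exp (2 i s) (B - 1/2) \<zeta>\<^sup>2))\<close> with \<open>B = 1 / (2 (4 b +
1))\<close>. Heuristically, \<open>F\<close> grows like \<open>exp (w \<zeta>\<^sup>2)\<close> with \<open>w\<close> confined to two discs, of centres
\<open>A - 1/2\<close> and \<open>exp (2 i s) (B - 1/2)\<close> and of radii \<open>A\<close> and \<open>B\<close>. The squared distance of the
centres is \<open>(A - B)\<^sup>2 + 64 A B a b sin\<^sup>2 s\<close>, so the hypothesis on \<open>a b sin\<^sup>2 s\<close> says exactly
that the discs do not overlap. Decreasing \<open>b\<close> reduces to the case where they touch in one
point \<open>w\<close>.

Divide \<open>F\<close> by \<open>exp (w \<zeta>\<^sup>2)\<close> and rotate \<open>\<zeta>\<close> so that the line of centres becomes real. The two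
bounds turn into \<open>C exp (2 A (Re \<zeta>)\<^sup>2)\<close> and \<open>C' exp (2 B (Im \<zeta>)\<^sup>2)\<close>, and an entire function
with both bounds is constant by a Phragmen-Lindelof argument
(\<open>entire_gaussian_bounds_imp_constant\<close>). The constant is zero because the first bound is not
attained: square integrability of the weighted \<open>\<phi>\<close> makes the factor \<open>C\<close> arbitrarily small
far out on the imaginary axis. This is what settles the borderline case, where a Gaussian
would otherwise survive.

So \<open>F = 0\<close> for every \<open>\<omega>\<close> (\<open>laplace_eq_0\<close>). In particular the Fourier transform of \<open>\<phi> d\<gamma>\<close>
vanishes, and \<open>\<phi> = 0\<close> by uniqueness (\<open>fourier_gaussian_unique\<close>).\<close>

section \<open>The Gaussian measure as a product measure\<close>

lemma measurable_vec_lambda_PiM [measurable]: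
  "(\<lambda>f. \<chi> i. f i :: real ^ 'd) \<in> (\<Pi>\<^sub>M i\<in>UNIV. lborel) \<rightarrow>\<^sub>M borel"
  by (auto simp: borel_measurable_euclidean_space[of "\<lambda>f. \<chi> i. f i :: real ^ 'd"] Basis_vec_def
      inner_axis
      intro!: measurable_component_singleton)

text \<open>The coordinates of \<open>real ^ 'd\<close> are indexed by a type, while Lebesgue measure is built
as a product over the basis. This form lets integrals of products over \<open>'d\<close> be computed
factor by factor.\<close>

lemma lborel_vec_eq:
  "(lborel :: (real ^ 'd) measure) = distr (\<Pi>\<^sub>M i\<in>UNIV. lborel) borel (\<lambda>f. \<chi> i. f i)"
proof (rule lborel_eqI)
  interpret product_sigma_finite "\<lambda>_::'d. lborel :: real measure" ..
  fix l u :: "real ^ 'd"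
  assume lu: "\<And>b. b \<in> Basis \<Longrightarrow> l \<bullet> b \<le> u \<bullet> b"
  have le: "l $ i \<le> u $ i" for i
    using lu[of "axis i 1"] by (auto simp: Basis_vec_def inner_axis)
  have "emeasure (distr (\<Pi>\<^sub>M i\<in>UNIV. lborel) borel (\<lambda>f. \<chi> i. f i)) (box l u)
     = emeasure (\<Pi>\<^sub>M i\<in>UNIV. lborel) (\<Pi>\<^sub>E i\<in>UNIV. {l $ i<..<u $ i})"
    by (subst emeasure_distr) (auto intro!: arg_cong2[where f = emeasure]
        simp: mem_box_cart space_PiM PiE_def Pi_def extensional_def)
  also have "\<dots> = (\<Prod>i\<in>UNIV. ennreal (u $ i - l $ i))"
    by (subst emeasure_PiM) (auto simp: le)
  also have "\<dots> = (\<Prod>b\<in>Basis. (u - l) \<bullet> b)"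
    using le by (subst prod_ennreal) (auto simp: Basis_vec_def  inner_axis inner_diff_left
        UNION_singleton_eq_range prod.reindex inj_on_def axis_eq_axis)
  finally show "emeasure (distr (\<Pi>\<^sub>M i\<in>UNIV. lborel) borel (\<lambda>f. \<chi> i. f i)) (box l u)
      = (\<Prod>b\<in>Basis. (u - l) \<bullet> b)" .
qed simp

lemma lborel_vec_prod:
  fixes f :: "'d::finite \<Rightarrow> real \<Rightarrow> 'a :: {real_normed_field, banach, second_countable_topology}"
  assumes "\<And>i. integrable lborel (f i)"
  shows integrable_lborel_vec_prod: "integrable lborel (\<lambda>x::real ^ 'd. \<Prod>i\<in>UNIV. f i (x $ i))"
    and integral_lborel_vec_prod:
      "(LINT x|(lborel :: (real ^ 'd) measure). (\<Prod>i\<in>UNIV. f i (x $ i)))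
          = (\<Prod>i\<in>UNIV. LINT x|lborel. f i x)"
proof -
  interpret product_sigma_finite "\<lambda>_::'d. lborel :: real measure" ..
  have [measurable]: "f i \<in> borel_measurable borel" for i
    using assms[of i] by (simp add: integrable_iff_bounded)
  show "integrable lborel (\<lambda>x::real ^ 'd. \<Prod>i\<in>UNIV. f i (x $ i))"
    unfolding lborel_vec_eq
    using product_integrable_prod[of UNIV f] assms by (subst integrable_distr_eq) auto
  show "(LINT x|(lborel :: (real ^ 'd) measure). (\<Prod>i\<in>UNIV. f i (x $ i)))
      = (\<Prod>i\<in>UNIV. LINT x|lborel. f i x)"
    unfolding lborel_vec_eq
    using product_integral_prod[of UNIV f] assms by (subst integral_distr) auto
qed

definition gaussian_density :: "real ^ 'd \<Rightarrow> real" where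
  "gaussian_density x = (2 * pi) powr (- real CARD('d) / 2) * exp (- (norm x)\<^sup>2 / 2)"

lemma norm_vec_square: "(norm (x :: real ^ 'd))\<^sup>2 = (\<Sum>i\<in>UNIV. (x $ i)\<^sup>2)"
  by (simp add: norm_vec_def L2_set_def sum_nonneg)

lemma gaussian_density_eq_prod: "gaussian_density (x :: real ^ 'd)
    = (\<Prod>i\<in>UNIV. std_normal_density (x $ i))"
proof -
  have "(1 / sqrt (2 * pi)) ^ CARD('d) = (2 * pi) powr (- real CARD('d) / 2)"
    by (simp add: powr_half_sqrt[symmetric] powr_minus_divide powr_powr[symmetric]
        powr_realpow power_divide powr_divide flip: powr_realpow)
       (simp add: powr_powr powr_minus_divide)
  then show ?thesis
    unfolding gaussian_density_def std_normal_density_def norm_vec_square prod.distrib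
    by (simp add: exp_sum[symmetric] sum_negf sum_divide_distrib)
qed

lemma gaussian_density_pos [simp]: "0 < gaussian_density x" "0 \<le> gaussian_density x"
  by (simp_all add: gaussian_density_def)

lemma gaussian_density_measurable [measurable]: "gaussian_density \<in> borel_measurable borel"
  unfolding gaussian_density_def by measurable

lemma gaussian_eq: "gaussian = density lborel (\<lambda>x. ennreal (gaussian_density x))"
  unfolding gaussian_def gaussian_density_def ..

lemma sets_gaussian [simp, measurable_cong]: "sets gaussian = sets borel"
  by (simp add: gaussian_def)

lemma space_gaussian [simp]: "space gaussian = UNIV"
  by (simp add: gaussian_def)

lemma gaussian_prod:
  fixes f :: "'d::finite \<Rightarrow> real \<Rightarrow> 'a :: {real_normed_field, banach, second_countable_topology}"
  assumes f: "\<And>i. integrable std_normal_distribution (f i)"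
  shows integrable_gaussian_prod: "integrable gaussian (\<lambda>x::real ^ 'd. \<Prod>i\<in>UNIV. f i (x $ i))"
    and integral_gaussian_prod:
      "(LINT x|(gaussian :: (real ^ 'd) measure). (\<Prod>i\<in>UNIV. f i (x $ i)))
         = (\<Prod>i\<in>UNIV. LINT x|std_normal_distribution. f i x)"
proof -
  have [measurable]: "f i \<in> borel_measurable borel" for i
    using f[of i] by (simp add: integrable_iff_bounded)
  define g where "g = (\<lambda>i x. std_normal_density x *\<^sub>R f i x)"
  have g: "integrable lborel (g i)" for i
    using f[of i] unfolding g_def by (subst (asm) integrable_density) auto
  have eq: "gaussian_density x *\<^sub>R (\<Prod>i\<in>UNIV. f i (x $ i)) = (\<Prod>i\<in>UNIV. g i (x $ i))"
      for x :: "real ^ 'd"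
    by (simp add: gaussian_density_eq_prod g_def scaleR_conv_of_real prod.distrib)
  show "integrable gaussian (\<lambda>x::real ^ 'd. \<Prod>i\<in>UNIV. f i (x $ i))"
    unfolding gaussian_eq using integrable_lborel_vec_prod[of g, OF g]
    by (subst integrable_density) (auto simp: eq)
  have "(LINT x|lborel. g i x) = (LINT x|std_normal_distribution. f i x)" for i
    unfolding g_def by (subst integral_density) auto
  then show "(LINT x|(gaussian :: (real ^ 'd) measure). (\<Prod>i\<in>UNIV. f i (x $ i)))
         = (\<Prod>i\<in>UNIV. LINT x|std_normal_distribution. f i x)"
    unfolding gaussian_eq using integral_lborel_vec_prod[of g, OF g]
    by (subst integral_density) (auto simp: eq)
qed

lemma prob_space_gaussian: "prob_space (gaussian :: (real ^ 'd) measure)"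
proof -
  interpret N: real_distribution std_normal_distribution by (rule real_dist_normal_dist)
  have N1: "N.prob UNIV = 1" using N.prob_space by simp
  have 1: "integrable gaussian (\<lambda>x::real ^ 'd. 1::real)"
      "(LINT x|(gaussian :: (real ^ 'd) measure). (1::real)) = 1"
    using gaussian_prod[of "\<lambda>_::'d. \<lambda>_. 1::real"] by (auto simp: N1)
  then interpret finite_measure "gaussian :: (real ^ 'd) measure"
    by (intro finite_measureI) (auto simp: integrable_iff_bounded less_top)
  show ?thesis
    using 1 by (intro prob_spaceI) (simp add: emeasure_eq_measure)
qed

section \<open>Hermite polynomials and the one-dimensional Gaussian\<close>

lemma measurable_poly_real [measurable]: "poly (p :: real poly) \<in> borel_measurable borel"
  by (intro borel_measurable_continuous_onI continuous_intros)

lemma exp_mult_std_normal_density: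
  "exp (u * x) * std_normal_density x = exp (u\<^sup>2 / 2) * normal_density u 1 x"
proof -
  have "u * x + (- x\<^sup>2 / 2) = u\<^sup>2 / 2 + (- (x - u)\<^sup>2 / 2)"
    by (simp add: power2_eq_square field_simps)
  then have "exp (u * x) * exp (- x\<^sup>2 / 2) = exp (u\<^sup>2 / 2) * exp (- (x - u)\<^sup>2 / 2)"
    by (metis exp_add)
  then show ?thesis by (simp add: normal_density_def)
qed

text \<open>Expanding \<open>p\<close> around the mean \<open>u\<close> reduces the claim to the centred moments.\<close>

lemma integrable_normal_density_poly:
  "integrable lborel (\<lambda>x. normal_density u 1 x * poly p x)"
proof -
  define q where "q = pcompose p [:u, 1:]"
  have "poly p x = poly q (x - u)" for x by (simp add: q_def poly_pcompose)
  then have "(\<lambda>x. normal_density u 1 x * poly p x)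
      = (\<lambda>x. \<Sum>k\<le>degree q. coeff q k * (normal_density u 1 x * (x - u) ^ k))"
    by (simp add: poly_altdef sum_distrib_left mult_ac)
  then show ?thesis
    using integrable_normal_moment[of 1 u] by (auto intro!: Bochner_Integration.integrable_sum
        integrable_mult_right)
qed

lemma integrable_normal_poly_exp:
  "integrable std_normal_distribution (\<lambda>x. complex_of_real (poly p x) * exp (\<zeta> * of_real x))"
proof -
  have "integrable lborel (\<lambda>x. exp ((Re \<zeta>)\<^sup>2 / 2) * (normal_density (Re \<zeta>) 1 x * poly p x))"
    by (intro integrable_mult_right integrable_normal_density_poly)
  then have "integrable lborel (\<lambda>x. exp (Re \<zeta> * x) * std_normal_density x * poly p x)"
    by (simp add: exp_mult_std_normal_density mult.assoc)
  then have "integrable lborel (\<lambda>x. std_normal_density x *\<^sub>R (complex_of_real (poly p x)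
      * exp (\<zeta> * of_real x)))"
  proof (rule Bochner_Integration.integrable_bound)
    show "(\<lambda>x. std_normal_density x *\<^sub>R (complex_of_real (poly p x) * exp (\<zeta> * of_real x)))
        \<in> borel_measurable lborel"
      by measurable
  qed (auto simp: norm_mult abs_mult)
  then show ?thesis by (subst integrable_density) auto
qed

text \<open>The real part of \<open>\<zeta>\<close> shifts the mean of the Gaussian; what remains is the
characteristic function.\<close>

lemma integral_normal_exp:
  "(LINT x|std_normal_distribution. exp (\<zeta> * complex_of_real x)) = exp (\<zeta>\<^sup>2 / 2)"
proof -
  define u v where "u = Re \<zeta>" and "v = Im \<zeta>"
  have z: "\<zeta> = of_real u + \<i> * of_real v" unfolding u_def v_def by (rule complex_eq)
  have nd: "normal_density u 1 (u + 1 * x) = std_normal_density x" for x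
    by (simp add: normal_density_def)
  have "(LINT x|std_normal_distribution. exp (\<zeta> * complex_of_real x))
      = (LINT x|lborel. std_normal_density x *\<^sub>R exp (\<zeta> * complex_of_real x))"
    by (subst integral_density) auto
  also have "\<dots> = (LINT x|lborel. exp (u\<^sup>2 / 2) *\<^sub>R (normal_density u 1 x *\<^sub>R exp (\<i> * of_real v
      * of_real x)))"
  proof (intro Bochner_Integration.integral_cong refl)
    fix x :: real
    have "std_normal_density x *\<^sub>R exp (\<zeta> * complex_of_real x)
      = of_real (exp (u * x) * std_normal_density x) * exp (\<i> * of_real v * of_real x)"
    proof -
      have "complex_of_real (exp (u * x)) = exp (of_real u * of_real x)"
        by (metis exp_of_real of_real_mult)
      then show ?thesis by (simp add: z exp_add ring_distribs scaleR_conv_of_real mult_ac)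
    qed
    then show "std_normal_density x *\<^sub>R exp (\<zeta> * complex_of_real x)
      = exp (u\<^sup>2 / 2) *\<^sub>R (normal_density u 1 x *\<^sub>R exp (\<i> * of_real v * of_real x))"
      unfolding exp_mult_std_normal_density by (simp add: scaleR_conv_of_real)
  qed
  also have "\<dots> = exp (u\<^sup>2 / 2) *\<^sub>R (LINT x|lborel. normal_density u 1 x *\<^sub>R exp (\<i> * of_real v
      * of_real x))"
    by (rule Bochner_Integration.integral_scaleR_right)
  also have "(LINT x|lborel. normal_density u 1 x *\<^sub>R exp (\<i> * of_real v * of_real x))
    = (LINT x|lborel. std_normal_density x *\<^sub>R exp (\<i> * of_real v * of_real (u + x)))"
    by (subst lborel_integral_real_affine[where c = 1 and t = u]) (simp_all add: nd[simplified])
  also have "\<dots> = exp (\<i> * of_real v * of_real u) * (LINT x|lborel. std_normal_density x *\<^sub>R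
      exp (\<i> * of_real v * of_real x))"
    by (simp add: exp_add ring_distribs scaleR_conv_of_real mult_ac flip: integral_mult_right_zero)
  also have "(LINT x|lborel. std_normal_density x *\<^sub>R exp (\<i> * of_real v * of_real x))
     = char std_normal_distribution v"
    unfolding char_def by (subst integral_density) (auto simp: mult_ac)
  also have "\<dots> = of_real (exp (- v\<^sup>2 / 2))"
    by (simp add: char_std_normal_distribution)
  finally show ?thesis
    unfolding scaleR_conv_of_real exp_of_real[symmetric] exp_add[symmetric]
    by (simp add: z power2_eq_square field_simps)
qed

lemma tendsto_poly_gauss_at_top:
  "((\<lambda>x::real. poly p x * exp (u * x - x\<^sup>2 / 2)) \<longlongrightarrow> 0) at_top"
proof -
  have "((\<lambda>x::real. x ^ k * exp (u * x - x\<^sup>2 / 2)) \<longlongrightarrow> 0) at_top" for k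
    by real_asymp
  then have "((\<lambda>x. \<Sum>k\<le>degree p. coeff p k * (x ^ k * exp (u * x - x\<^sup>2 / 2))) \<longlongrightarrow> 0) at_top"
    by (intro tendsto_null_sum tendsto_mult_right_zero)
  then show ?thesis by (simp add: poly_altdef sum_distrib_right mult_ac)
qed

lemma tendsto_poly_gauss_at_bot:
  "((\<lambda>x::real. poly p x * exp (u * x - x\<^sup>2 / 2)) \<longlongrightarrow> 0) at_bot"
  unfolding filterlim_at_bot_mirror
  using tendsto_poly_gauss_at_top[of "pcompose p [:0, -1:]" "-u"] by (simp add: poly_pcompose)

text \<open>The operator \<open>x - d/dx\<close> that raises the degree of a Hermite polynomial is the adjoint
of \<open>d/dx\<close> for the Gaussian weight, and differentiation multiplies the exponential by \<open>\<zeta>\<close>.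
Both the generating function and orthogonality follow from this identity.\<close>

lemma integral_normal_by_parts:
  "(LINT x|std_normal_distribution. complex_of_real (poly ([:0, 1:] * p - pderiv p) x)
      * exp (\<zeta> * of_real x))
   = \<zeta> * (LINT x|std_normal_distribution. complex_of_real (poly p x) * exp (\<zeta> * of_real x))"
proof -
  let ?N = "std_normal_distribution"
  define F where "F = (\<lambda>x. complex_of_real (poly p x) * exp (\<zeta> * of_real x - of_real x ^ 2 / 2))"
  define f where "f = (\<lambda>x. (of_real (poly (pderiv p) x) + \<zeta> * of_real (poly p x) - of_real x
      * of_real (poly p x))
      * exp (\<zeta> * of_real x - complex_of_real x ^ 2 / 2))"
  have F: "(F has_vector_derivative f x) (at x)" for x
  proof -
    have 1: "((\<lambda>x. complex_of_real (poly p x)) has_vector_derivative of_real (poly (pderiv p) x))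
        (at x)"
      by (intro has_vector_derivative_of_real poly_DERIV)
    have 2: "((\<lambda>x. exp (\<zeta> * of_real x - of_real x ^ 2 / 2)) has_vector_derivative
        (\<zeta> - of_real x) * exp (\<zeta> * of_real x - complex_of_real x ^ 2 / 2)) (at x)"
      by (rule has_vector_derivative_real_field[where f = "\<lambda>z. exp (\<zeta> * z - z ^ 2 / 2)"])
         (auto intro!: derivative_eq_intros)
    show ?thesis
      unfolding F_def f_def
      by (rule has_vector_derivative_eq_rhs[OF has_vector_derivative_mult[OF 1 2]])
          (simp add: algebra_simps)
  qed
  have w: "std_normal_density x *\<^sub>R exp (\<zeta> * of_real x) = of_real (1 / sqrt (2 * pi))
      * exp (\<zeta> * of_real x - complex_of_real x ^ 2 / 2)" for x
  proof -
    have "- (complex_of_real x ^ 2 / 2) = complex_of_real (- x\<^sup>2 / 2)" by simp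
    then have "exp (- (complex_of_real x ^ 2 / 2)) = complex_of_real (exp (- x\<^sup>2 / 2))"
      by (simp only: exp_of_real)
    moreover have "exp (\<zeta> * of_real x - complex_of_real x ^ 2 / 2)
        = exp (\<zeta> * of_real x) * exp (- (complex_of_real x ^ 2 / 2))"
      by (simp add: exp_add[symmetric])
    ultimately show ?thesis
      unfolding std_normal_density_def scaleR_conv_of_real of_real_mult by (simp only: mult_ac)
  qed
  define g where "g = (\<lambda>x. of_real (poly (pderiv p) x) * exp (\<zeta> * of_real x) + \<zeta>
      * (of_real (poly p x) * exp (\<zeta> * complex_of_real x))
      - of_real (poly ([:0,1:] * p) x) * exp (\<zeta> * of_real x))"
  have gi: "integrable ?N g" unfolding g_def
    by (intro Bochner_Integration.integrable_diff Bochner_Integration.integrable_add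
        integrable_mult_right integrable_normal_poly_exp)
  have fg: "std_normal_density x *\<^sub>R g x = of_real (1 / sqrt (2 * pi)) * f x" for x
  proof -
    have "std_normal_density x *\<^sub>R g x = (of_real (poly (pderiv p) x) + \<zeta> * of_real (poly p x)
        - of_real x * of_real (poly p x)) * 
      (std_normal_density x *\<^sub>R exp (\<zeta> * of_real x))"
      unfolding g_def scaleR_conv_of_real by (simp add: ring_distribs mult_ac)
    then show ?thesis unfolding w f_def by (simp only: mult_ac)
  qed
  have [measurable]: "g \<in> borel_measurable borel" using gi by (simp add: integrable_iff_bounded)
  have "integrable lborel (\<lambda>x. std_normal_density x *\<^sub>R g x)"
    using gi by (subst (asm) integrable_density) auto
  then have fi: "integrable lborel f"
  proof -
    have "f = (\<lambda>x. of_real (sqrt (2 * pi)) * (std_normal_density x *\<^sub>R g x))"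
      unfolding fg by (simp add: fun_eq_iff)
    then show ?thesis
      using integrable_mult_right[OF \<open>integrable lborel (\<lambda>x. std_normal_density x *\<^sub>R g x)\<close>] by simp
  qed
  have lim: "(F \<longlongrightarrow> 0) at_top" "(F \<longlongrightarrow> 0) at_bot"
  proof -
    have n: "norm (F x) = norm (poly p x * exp (Re \<zeta> * x - x\<^sup>2 / 2))" for x
    proof -
      have "complex_of_real x ^ 2 / 2 = complex_of_real (x\<^sup>2 / 2)" by simp
      then have "Re (\<zeta> * of_real x - complex_of_real x ^ 2 / 2) = Re \<zeta> * x - x\<^sup>2 / 2"
        by (simp only: minus_complex.sel times_complex.sel Re_complex_of_real Im_complex_of_real
            mult_zero_right diff_zero)
      then show ?thesis
        unfolding F_def norm_mult norm_exp_eq_Re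
            by (simp only: norm_of_real real_norm_def abs_exp_cancel)
    qed
    show "(F \<longlongrightarrow> 0) at_top"
      by (rule tendsto_norm_zero_cancel) (unfold n,
          intro tendsto_norm_zero tendsto_poly_gauss_at_top)
    show "(F \<longlongrightarrow> 0) at_bot"
      by (rule tendsto_norm_zero_cancel) (unfold n,
          intro tendsto_norm_zero tendsto_poly_gauss_at_bot)
  qed
  have "(LBINT x=-\<infinity>..\<infinity>. f x) = 0 - 0"
  proof (rule interval_integral_FTC_integrable[where F = F])
    show "isCont f x" for x unfolding f_def by (intro continuous_intros) simp
    show "set_integrable lborel (einterval (-\<infinity>) \<infinity>) f"
      using fi by (simp add: set_integrable_def einterval_def)
    show "((F \<circ> real_of_ereal) \<longlongrightarrow> 0) (at_right (- \<infinity>))"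
      using lim by (simp add: at_right_MInf tendsto_compose_filtermap[symmetric]
          filterlim_filtermap o_def)
    show "((F \<circ> real_of_ereal) \<longlongrightarrow> 0) (at_left \<infinity>)"
      using lim by (simp add: at_left_PInf filterlim_filtermap o_def)
  qed (use F in auto)
  then have "(LINT x|lborel. f x) = 0"
    by (simp add: interval_lebesgue_integral_def set_lebesgue_integral_def)
  moreover have "(LINT x|?N. g x) = of_real (1 / sqrt (2 * pi)) * (LINT x|lborel. f x)"
    by (subst integral_density) (auto simp: fg)
  ultimately have 0: "(LINT x|?N. g x) = 0" by simp
  have "(LINT x|?N. complex_of_real (poly ([:0, 1:] * p - pderiv p) x) * exp (\<zeta> * of_real x))
    = (LINT x|?N. \<zeta> * (complex_of_real (poly p x) * exp (\<zeta> * of_real x)) - g x)"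
    by (intro Bochner_Integration.integral_cong refl) (simp add: g_def algebra_simps)
  also have "\<dots> = (LINT x|?N. \<zeta> * (complex_of_real (poly p x) * exp (\<zeta> * of_real x)))
      - (LINT x|?N. g x)"
    by (intro Bochner_Integration.integral_diff gi integrable_mult_right integrable_normal_poly_exp)
  finally show ?thesis using 0 by simp
qed

lemma integral_hermite_exp:
  "(LINT x|std_normal_distribution. complex_of_real (poly (hermite_poly n) x) * exp (\<zeta> * of_real x))
   = \<zeta> ^ n * exp (\<zeta>\<^sup>2 / 2)"
proof (induction n)
  case 0
  then show ?case by (simp add: integral_normal_exp)
next
  case (Suc n)
  then show ?case unfolding hermite_poly.simps integral_normal_by_parts by simp
qed

lemma integrable_normal_poly: "integrable std_normal_distribution (\<lambda>x. poly p x)"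
proof -
  have "integrable std_normal_distribution (\<lambda>x. Re (complex_of_real (poly p x)
      * exp (0 * of_real x)))"
    by (intro integrable_Re integrable_normal_poly_exp)
  then show ?thesis by simp
qed

lemma integral_normal_poly_by_parts:
  "(LINT x|std_normal_distribution. poly (([:0, 1:] * p - pderiv p) * q) x)
     = (LINT x|std_normal_distribution. poly (p * pderiv q) x)"
proof -
  have "complex_of_real (LINT x|std_normal_distribution. poly ([:0, 1:] * (p * q) - pderiv
      (p * q)) x) = 0"
    using integral_normal_by_parts[of "p * q" 0]
    unfolding integral_complex_of_real[symmetric]
        by (simp only: mult_zero_left exp_zero mult_1_right)
  moreover have "[:0, 1:] * (p * q) - pderiv (p * q) = ([:0, 1:] * p - pderiv p) * q - p * pderiv q"
  proof -
    have "X * (p * q) - (p * q' + q * p') = (X * p - p') * q - p * q'" for X q' p' :: "real poly"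
      by (simp add: algebra_simps)
    then show ?thesis by (simp only: pderiv_mult)
  qed
  ultimately have "(LINT x|std_normal_distribution. poly (([:0, 1:] * p - pderiv p) * q) x
      - poly (p * pderiv q) x) = 0"
    by (simp only: poly_diff of_real_eq_0_iff)
  then show ?thesis
    by (simp only: Bochner_Integration.integral_diff integrable_normal_poly right_minus_eq)
qed

text \<open>The raising operator moves from one factor to the other as a derivative, which lowers
the degree there by one; iterating reaches degree zero.\<close>

lemma hermite_orthogonal:
  "(LINT x|std_normal_distribution. poly (hermite_poly m * hermite_poly n) x)
      = (if m = n then fact n else 0)"
proof (induction m arbitrary: n)
  interpret N: real_distribution std_normal_distribution by (rule real_dist_normal_dist)
  have N1: "N.prob UNIV = 1" using N.prob_space by simp
  have p0: "poly (0 :: real poly) = (\<lambda>x. 0)" by auto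
  have S0: "(LINT x|std_normal_distribution. poly (hermite_poly (Suc m) * hermite_poly 0) x) = 0"
      for m
    unfolding hermite_poly.simps(2) integral_normal_poly_by_parts
    by (simp only: hermite_poly.simps(1) pderiv_1 mult_zero_right p0 integral_zero)
  case 0
  show ?case
  proof (cases n)
    case 0 then show ?thesis by (simp add: N1)
  next
    case (Suc k) then show ?thesis using S0[of k] by (simp add: mult.commute)
  qed
next
  case (Suc m)
  have "(LINT x|std_normal_distribution. poly (hermite_poly (Suc m) * hermite_poly n) x)
     = (LINT x|std_normal_distribution. poly (hermite_poly m * pderiv (hermite_poly n)) x)"
    unfolding hermite_poly.simps(2) integral_normal_poly_by_parts ..
  also have "\<dots> = (if Suc m = n then fact n else 0)"
  proof (cases n)
    case 0 then show ?thesis by simp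
  next
    case (Suc k)
    show ?thesis unfolding Suc pderiv_hermite_poly
      using Suc.IH[of k] by (simp add: mult_ac del: hermite_poly.simps)
  qed
  finally show ?case .
qed

section \<open>Square-integrable functions\<close>

lemma mult_cnj_cmod: "z * cnj z = (of_real (cmod z))\<^sup>2"
  by (simp only: complex_norm_square[symmetric] of_real_power)

lemma mult_cnj_cmod_power: "z ^ k * cnj z ^ k = of_real (((cmod z)\<^sup>2) ^ k)"
  by (simp only: power_mult_distrib[symmetric] mult_cnj_cmod of_real_power)

lemma L2_D:
  assumes "f \<in> L2 M"
  shows "f \<in> borel_measurable M" "integrable M (\<lambda>x. (cmod (f x))\<^sup>2)"
  using assms by (auto simp: L2_def)

lemma L2_add: assumes "f \<in> L2 M" "g \<in> L2 M" shows "(\<lambda>x. f x + g x) \<in> L2 M"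
proof -
  note [measurable] = L2_D(1)[OF assms(1)] L2_D(1)[OF assms(2)]
  have "integrable M (\<lambda>x. (cmod (f x + g x))\<^sup>2)"
  proof (rule Bochner_Integration.integrable_bound)
    show "integrable M (\<lambda>x. 2 * (cmod (f x))\<^sup>2 + 2 * (cmod (g x))\<^sup>2)"
      using assms[THEN L2_D(2)] by simp
    have "(cmod (f x + g x))\<^sup>2 \<le> 2 * (cmod (f x))\<^sup>2 + 2 * (cmod (g x))\<^sup>2" for x
    proof -
      have "(cmod (f x + g x))\<^sup>2 \<le> (cmod (f x) + cmod (g x))\<^sup>2"
        by (intro power_mono norm_triangle_ineq) simp
      also have "\<dots> \<le> 2 * (cmod (f x))\<^sup>2 + 2 * (cmod (g x))\<^sup>2"
        using sum_squares_bound[of "cmod (f x)" "cmod (g x)"] by (simp add: power2_sum)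
      finally show ?thesis .
    qed
    then show "AE x in M. norm ((cmod (f x + g x))\<^sup>2)
        \<le> norm (2 * (cmod (f x))\<^sup>2 + 2 * (cmod (g x))\<^sup>2)"
      by (simp add: abs_of_nonneg)
  qed measurable
  then show ?thesis by (simp add: L2_def)
qed

lemma L2_cmult: assumes "f \<in> L2 M" shows "(\<lambda>x. c * f x) \<in> L2 M"
  using assms by (auto simp: L2_def norm_mult power_mult_distrib)

lemma L2_zero: "(\<lambda>x. 0) \<in> L2 M"
  by (auto simp: L2_def)

lemma L2_sum: assumes "\<And>i. i \<in> A \<Longrightarrow> f i \<in> L2 M" shows "(\<lambda>x. \<Sum>i\<in>A. f i x) \<in> L2 M"
  using assms by (induction A rule: infinite_finite_induct) (auto intro: L2_zero L2_add)

lemma L2_diff: assumes "f \<in> L2 M" "g \<in> L2 M" shows "(\<lambda>x. f x - g x) \<in> L2 M"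
  using L2_add[OF assms(1) L2_cmult[OF assms(2), of "-1"]] by simp

lemma L2_Cauchy_Schwarz:
  assumes "f \<in> L2 M" "g \<in> L2 M"
  shows L2_mult_integrable: "integrable M (\<lambda>x. f x * g x)"
    and "(cmod (LINT x|M. f x * g x))\<^sup>2 \<le> (LINT x|M. (cmod (f x))\<^sup>2) * (LINT x|M. (cmod (g x))\<^sup>2)"
proof -
  note [measurable] = L2_D(1)[OF assms(1)] L2_D(1)[OF assms(2)]
  show i: "integrable M (\<lambda>x. f x * g x)"
  proof (rule Bochner_Integration.integrable_bound)
    show "integrable M (\<lambda>x. (cmod (f x))\<^sup>2 + (cmod (g x))\<^sup>2)"
      using assms[THEN L2_D(2)] by simp
    have "cmod (f x) * cmod (g x) \<le> (cmod (f x))\<^sup>2 + (cmod (g x))\<^sup>2" for x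
      using sum_squares_bound[of "cmod (f x)" "cmod (g x)"]
        mult_nonneg_nonneg[OF norm_ge_zero norm_ge_zero, of "f x" "g x"] by linarith
    then show "AE x in M. norm (f x * g x) \<le> norm ((cmod (f x))\<^sup>2 + (cmod (g x))\<^sup>2)"
      by (simp add: norm_mult)
  qed measurable
  have nn: "(\<integral>\<^sup>+x. (ennreal (cmod (h x)))\<^sup>2 \<partial>M) = ennreal (LINT x|M. (cmod (h x))\<^sup>2)" if "h
      \<in> L2 M" for h
    using L2_D(2)[OF that] by (simp add: nn_integral_eq_integral ennreal_power)
  have "ennreal ((LINT x|M. cmod (f x * g x))\<^sup>2)
      = (\<integral>\<^sup>+x. ennreal (cmod (f x)) * ennreal (cmod (g x)) \<partial>M)\<^sup>2"
    using integrable_norm[OF i]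
    by (simp add: nn_integral_eq_integral[symmetric] ennreal_power[symmetric] ennreal_mult
        norm_mult)
  also have "\<dots> \<le> (\<integral>\<^sup>+x. (ennreal (cmod (f x)))\<^sup>2 \<partial>M) * (\<integral>\<^sup>+x. (ennreal (cmod (g x)))\<^sup>2 \<partial>M)"
    by (rule Cauchy_Schwarz_nn_integral) measurable
  also have "\<dots> = ennreal ((LINT x|M. (cmod (f x))\<^sup>2) * (LINT x|M. (cmod (g x))\<^sup>2))"
    by (simp add: nn assms ennreal_mult)
  finally have "(LINT x|M. cmod (f x * g x))\<^sup>2 \<le> (LINT x|M. (cmod (f x))\<^sup>2)
      * (LINT x|M. (cmod (g x))\<^sup>2)"
    by (simp add: ennreal_le_iff)
  moreover have "(cmod (LINT x|M. f x * g x))\<^sup>2 \<le> (LINT x|M. cmod (f x * g x))\<^sup>2"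
    by (intro power_mono integral_norm_bound) simp
  ultimately show "(cmod (LINT x|M. f x * g x))\<^sup>2 \<le> (LINT x|M. (cmod (f x))\<^sup>2)
      * (LINT x|M. (cmod (g x))\<^sup>2)"
    by linarith
qed

text \<open>Convergence in norm implies weak convergence.\<close>

lemma L2_tendsto_integral_mult:
  assumes f: "f \<in> L2 M" and g: "g \<in> L2 M" and h: "\<And>n. h n \<in> L2 M"
    and lim: "((\<lambda>n. LINT x|M. (cmod (g x - h n x))\<^sup>2) \<longlongrightarrow> 0) F"
  shows "((\<lambda>n. LINT x|M. f x * h n x) \<longlongrightarrow> (LINT x|M. f x * g x)) F"
proof -
  have "((\<lambda>n. sqrt ((LINT x|M. (cmod (f x))\<^sup>2) * (LINT x|M. (cmod (g x - h n x))\<^sup>2)))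
      \<longlongrightarrow> sqrt ((LINT x|M. (cmod (f x))\<^sup>2) * 0)) F"
    by (intro tendsto_intros lim)
  then have "((\<lambda>n. sqrt ((LINT x|M. (cmod (f x))\<^sup>2) * (LINT x|M. (cmod (g x - h n x))\<^sup>2))) \<longlongrightarrow> 0) F"
    by simp
  then have "((\<lambda>n. (LINT x|M. f x * g x) - (LINT x|M. f x * h n x)) \<longlongrightarrow> 0) F"
  proof (rule Lim_null_comparison[rotated])
    have "norm ((LINT x|M. f x * g x) - (LINT x|M. f x * h n x))
      \<le> sqrt ((LINT x|M. (cmod (f x))\<^sup>2) * (LINT x|M. (cmod (g x - h n x))\<^sup>2))" for n
    proof -
      have "(LINT x|M. f x * g x) - (LINT x|M. f x * h n x) = (LINT x|M. f x * (g x - h n x))"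
        by (simp add: right_diff_distrib Bochner_Integration.integral_diff L2_mult_integrable f g h)
      then show ?thesis
        using L2_Cauchy_Schwarz(2)[OF f L2_diff[OF g h]] by (simp add: real_le_rsqrt)
    qed
    then show "\<forall>\<^sub>F n in F. norm ((LINT x|M. f x * g x) - (LINT x|M. f x * h n x))
      \<le> sqrt ((LINT x|M. (cmod (f x))\<^sup>2) * (LINT x|M. (cmod (g x - h n x))\<^sup>2))" by simp
  qed
  from tendsto_diff[OF tendsto_const[of "LINT x|M. f x * g x"] this] show ?thesis by simp
qed

section \<open>The generating function of the Hermite polynomials\<close>

text \<open>The sum of the series \<open>\<Sum>n. \<zeta>^n / n! * He n x\<close>, whose partial sums are \<open>hermite_sum1\<close>
below.\<close>

definition genfun1 :: "complex \<Rightarrow> real \<Rightarrow> complex" where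
  "genfun1 \<zeta> x = exp (\<zeta> * of_real x - \<zeta>\<^sup>2 / 2)"

definition hermite_sum1 :: "nat \<Rightarrow> complex \<Rightarrow> real \<Rightarrow> complex" where
  "hermite_sum1 n \<zeta> x = (\<Sum>k\<le>n. \<zeta> ^ k / fact k * of_real (poly (hermite_poly k) x))"

definition genfun :: "('d \<Rightarrow> complex) \<Rightarrow> real ^ 'd \<Rightarrow> complex" where
  "genfun z x = (\<Prod>i\<in>UNIV. genfun1 (z i) (x $ i))"

definition hermite_sum :: "nat \<Rightarrow> ('d \<Rightarrow> complex) \<Rightarrow> real ^ 'd \<Rightarrow> complex" where
  "hermite_sum n z x = (\<Prod>i\<in>UNIV. hermite_sum1 n (z i) (x $ i))"

lemma genfun1_eq_exp: "genfun1 \<zeta> x = exp (- (\<zeta>\<^sup>2 / 2)) * exp (\<zeta> * of_real x)"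
  by (simp add: genfun1_def exp_add[symmetric])

lemma hermite_genfun1:
  "integrable std_normal_distribution (\<lambda>x. of_real (poly p x) * genfun1 \<zeta> x)"
  "(LINT x|std_normal_distribution. of_real (poly (hermite_poly n) x) * genfun1 \<zeta> x) = \<zeta> ^ n"
proof -
  have eq: "of_real (poly q x) * genfun1 \<zeta> x = exp (- (\<zeta>\<^sup>2 / 2)) * (of_real (poly q x)
      * exp (\<zeta> * of_real x))" for q x
    by (simp add: genfun1_eq_exp)
  show "integrable std_normal_distribution (\<lambda>x. of_real (poly p x) * genfun1 \<zeta> x)"
    unfolding eq by (intro integrable_mult_right integrable_normal_poly_exp)
  show "(LINT x|std_normal_distribution. of_real (poly (hermite_poly n) x) * genfun1 \<zeta> x) = \<zeta> ^ n"
    unfolding eq integral_mult_right_zero integral_hermite_exp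
    by (simp add: exp_minus)
qed

lemma genfun1_norm:
  "integrable std_normal_distribution (\<lambda>x. genfun1 \<zeta> x * cnj (genfun1 \<zeta> x))"
  "(LINT x|std_normal_distribution. genfun1 \<zeta> x * cnj (genfun1 \<zeta> x)) = of_real (exp ((cmod \<zeta>)\<^sup>2))"
proof -
  have eq: "genfun1 \<zeta> x * cnj (genfun1 \<zeta> x)
     = exp (- (\<zeta>\<^sup>2 / 2) - (cnj \<zeta>)\<^sup>2 / 2) * (of_real (poly 1 x) * exp ((\<zeta> + cnj \<zeta>) * of_real x))"
         for x
    by (simp add: genfun1_def exp_cnj exp_add[symmetric] algebra_simps)
  show "integrable std_normal_distribution (\<lambda>x. genfun1 \<zeta> x * cnj (genfun1 \<zeta> x))"
    unfolding eq by (intro integrable_mult_right integrable_normal_poly_exp)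
  have "- (\<zeta>\<^sup>2 / 2) - (cnj \<zeta>)\<^sup>2 / 2 + (\<zeta> + cnj \<zeta>)\<^sup>2 / 2 = \<zeta> * cnj \<zeta>"
    by (simp add: power2_eq_square field_simps)
  also have "\<dots> = of_real ((cmod \<zeta>)\<^sup>2)"
    by (simp only: mult_cnj_cmod of_real_power)
  finally have "exp (- (\<zeta>\<^sup>2 / 2) - (cnj \<zeta>)\<^sup>2 / 2) * exp ((\<zeta> + cnj \<zeta>)\<^sup>2 / 2)
      = of_real (exp ((cmod \<zeta>)\<^sup>2))"
    by (metis exp_add exp_of_real)
  then show "(LINT x|std_normal_distribution. genfun1 \<zeta> x * cnj (genfun1 \<zeta> x))
      = of_real (exp ((cmod \<zeta>)\<^sup>2))"
    unfolding eq integral_mult_right_zero by (simp add: integral_normal_exp)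
qed

definition exp_partial_sum :: "nat \<Rightarrow> real \<Rightarrow> real" where
  "exp_partial_sum n t = (\<Sum>k\<le>n. t ^ k / fact k)"

text \<open>The mixed product and the squared norm of the partial sum agree, since the partial
sum is the orthogonal projection of the generating function.\<close>

lemma genfun1_hermite_sum1:
  "integrable std_normal_distribution (\<lambda>x. genfun1 \<zeta> x * cnj (hermite_sum1 n \<zeta> x))"
  "(LINT x|std_normal_distribution. genfun1 \<zeta> x * cnj (hermite_sum1 n \<zeta> x))
      = of_real (exp_partial_sum n ((cmod \<zeta>)\<^sup>2))"
proof -
  have eq: "genfun1 \<zeta> x * cnj (hermite_sum1 n \<zeta> x)
     = (\<Sum>k\<le>n. cnj \<zeta> ^ k / fact k * (of_real (poly (hermite_poly k) x) * genfun1 \<zeta> x))" for x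
    by (simp add: hermite_sum1_def sum_distrib_left mult_ac)
  have i: "integrable std_normal_distribution (\<lambda>x. cnj \<zeta> ^ k / fact k
      * (of_real (poly (hermite_poly k) x) * genfun1 \<zeta> x))" for k
    by (intro integrable_mult_right hermite_genfun1)
  show "integrable std_normal_distribution (\<lambda>x. genfun1 \<zeta> x * cnj (hermite_sum1 n \<zeta> x))"
    unfolding eq by (intro Bochner_Integration.integrable_sum i)
  have "(LINT x|std_normal_distribution. genfun1 \<zeta> x * cnj (hermite_sum1 n \<zeta> x))
      = (\<Sum>k\<le>n. cnj \<zeta> ^ k / fact k * \<zeta> ^ k)"
    unfolding eq Bochner_Integration.integral_sum[OF i] integral_mult_right_zero
        hermite_genfun1(2) ..
  also have "\<dots> = of_real (exp_partial_sum n ((cmod \<zeta>)\<^sup>2))"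
  proof -
    have "cnj \<zeta> ^ k * \<zeta> ^ k = of_real (((cmod \<zeta>)\<^sup>2) ^ k)" for k
      using mult_cnj_cmod_power[of \<zeta> k] by (simp only: mult.commute)
    then show ?thesis by (simp add: exp_partial_sum_def)
  qed
  finally show "(LINT x|std_normal_distribution. genfun1 \<zeta> x * cnj (hermite_sum1 n \<zeta> x))
      = of_real (exp_partial_sum n ((cmod \<zeta>)\<^sup>2))" .
qed

lemma hermite_orthogonal_complex:
  "integrable std_normal_distribution (\<lambda>x. complex_of_real (poly (hermite_poly m) x) * of_real
      (poly (hermite_poly n) x))"
  "(LINT x|std_normal_distribution. complex_of_real (poly (hermite_poly m) x) * of_real
      (poly (hermite_poly n) x)) = (if m = n then fact n else 0)"
proof -
  have eq: "complex_of_real (poly (hermite_poly m) x) * of_real (poly (hermite_poly n) x)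
     = of_real (poly (hermite_poly m * hermite_poly n) x)" for x by simp
  show "integrable std_normal_distribution (\<lambda>x. complex_of_real (poly (hermite_poly m) x)
      * of_real (poly (hermite_poly n) x))"
    unfolding eq by (intro integrable_of_real integrable_normal_poly)
  show "(LINT x|std_normal_distribution. complex_of_real (poly (hermite_poly m) x) * of_real
      (poly (hermite_poly n) x)) = (if m = n then fact n else 0)"
    unfolding eq integral_complex_of_real hermite_orthogonal by simp
qed

lemma hermite_sum1_norm:
  "integrable std_normal_distribution (\<lambda>x. hermite_sum1 n \<zeta> x * cnj (hermite_sum1 n \<zeta> x))"
  "(LINT x|std_normal_distribution. hermite_sum1 n \<zeta> x * cnj (hermite_sum1 n \<zeta> x))
      = of_real (exp_partial_sum n ((cmod \<zeta>)\<^sup>2))"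
proof -
  let ?h = "\<lambda>k x. complex_of_real (poly (hermite_poly k) x)"
  have eq: "hermite_sum1 n \<zeta> x * cnj (hermite_sum1 n \<zeta> x)
     = (\<Sum>j\<le>n. \<Sum>k\<le>n. (\<zeta> ^ j / fact j * (cnj \<zeta> ^ k / fact k)) * (?h j x * ?h k x))" for x
    by (simp add: hermite_sum1_def sum_product mult_ac)
  have i: "integrable std_normal_distribution (\<lambda>x. (\<zeta> ^ j / fact j * (cnj \<zeta> ^ k / fact k))
      * (?h j x * ?h k x))" for j k
    by (intro integrable_mult_right hermite_orthogonal_complex)
  show "integrable std_normal_distribution (\<lambda>x. hermite_sum1 n \<zeta> x * cnj (hermite_sum1 n \<zeta> x))"
    unfolding eq by (intro Bochner_Integration.integrable_sum i)
  have "(LINT x|std_normal_distribution. hermite_sum1 n \<zeta> x * cnj (hermite_sum1 n \<zeta> x))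
     = (\<Sum>j\<le>n. \<Sum>k\<le>n. (\<zeta> ^ j / fact j * (cnj \<zeta> ^ k / fact k)) * (if j = k then fact k else 0))"
    unfolding eq
    by (subst Bochner_Integration.integral_sum, intro Bochner_Integration.integrable_sum i,
        subst Bochner_Integration.integral_sum, rule i,
        simp only: integral_mult_right_zero hermite_orthogonal_complex)
  also have "\<dots> = (\<Sum>j\<le>n. \<Sum>k\<le>n. if j = k then of_real (((cmod \<zeta>)\<^sup>2) ^ j / fact j) else 0)"
  proof (intro sum.cong refl)
    fix j k
    have "\<zeta> ^ j * cnj \<zeta> ^ j = of_real (((cmod \<zeta>)\<^sup>2) ^ j)"
      by (rule mult_cnj_cmod_power)
    then show "(\<zeta> ^ j / fact j * (cnj \<zeta> ^ k / fact k)) * (if j = k then fact k else 0)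
        = (if j = k then of_real (((cmod \<zeta>)\<^sup>2) ^ j / fact j) else 0)"
      by auto
  qed
  also have "\<dots> = of_real (exp_partial_sum n ((cmod \<zeta>)\<^sup>2))"
    by (simp add: exp_partial_sum_def)
  finally show "(LINT x|std_normal_distribution. hermite_sum1 n \<zeta> x * cnj (hermite_sum1 n \<zeta> x))
      = of_real (exp_partial_sum n ((cmod \<zeta>)\<^sup>2))" .
qed

lemma exp_partial_sum_tendsto: "(\<lambda>n. exp_partial_sum n t) \<longlonglongrightarrow> exp t"
  unfolding exp_partial_sum_def using exp_converges[of t]
      by (simp add: sums_def_le divide_inverse mult.commute)

lemma measurable_genfun [measurable]: "genfun z \<in> borel_measurable borel"
  unfolding genfun_def genfun1_def by measurable

lemma measurable_hermite_sum [measurable]: "hermite_sum n z \<in> borel_measurable borel"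
  unfolding hermite_sum_def hermite_sum1_def by measurable

lemma L2_if_integrable_cnj:
  assumes "f \<in> borel_measurable M" "integrable M (\<lambda>x. f x * cnj (f x))" shows "f \<in> L2 M"
proof -
  have "(cmod (f x))\<^sup>2 = Re (f x * cnj (f x))" for x
    by (simp only: complex_norm_square[symmetric] Re_complex_of_real)
  then show ?thesis using assms integrable_Re[OF assms(2)] by (simp add: L2_def)
qed

lemma genfun_L2: "genfun z \<in> L2 gaussian"
  and hermite_sum_L2: "hermite_sum n z \<in> L2 gaussian"
proof -
  have "genfun z x * cnj (genfun z x) = (\<Prod>i\<in>UNIV. genfun1 (z i) (x $ i) * cnj (genfun1 (z i)
      (x $ i)))"
    "hermite_sum n z x * cnj (hermite_sum n z x) = (\<Prod>i\<in>UNIV. hermite_sum1 n (z i) (x $ i) * cnj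
        (hermite_sum1 n (z i) (x $ i)))" for x
    by (simp_all only: genfun_def hermite_sum_def cnj_prod prod.distrib)
  then show "genfun z \<in> L2 gaussian" "hermite_sum n z \<in> L2 gaussian"
    by (auto intro!: L2_if_integrable_cnj integrable_gaussian_prod[where f
        = "\<lambda>i t. genfun1 (z i) t * cnj (genfun1 (z i) t)"]
      integrable_gaussian_prod[where f = "\<lambda>i t. hermite_sum1 n (z i) t * cnj (hermite_sum1 n (z i)
          t)"] genfun1_norm hermite_sum1_norm
      simp del: complex_mult_cnj)
qed

lemma L2_cnj: "f \<in> L2 M \<Longrightarrow> (\<lambda>x. cnj (f x)) \<in> L2 M"
  by (auto simp: L2_def intro: measurable_compose[OF _ borel_measurable_continuous_onI[OF
      continuous_on_cnj[OF continuous_on_id]]])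

text \<open>Pythagoras: the partial sum is an orthogonal projection of the generating function,
so the squared error is the difference of the squared norms.\<close>

lemma genfun_hermite_sum_dist:
  "(LINT x|gaussian. (cmod (genfun z x - hermite_sum n z x))\<^sup>2)
     = (\<Prod>i\<in>UNIV. exp ((cmod (z i))\<^sup>2)) - (\<Prod>i\<in>UNIV. exp_partial_sum n ((cmod (z i))\<^sup>2))"
proof -
  let ?E = "(\<Prod>i\<in>UNIV. exp ((cmod (z i))\<^sup>2))" and ?S
      = "(\<Prod>i\<in>UNIV. exp_partial_sum n ((cmod (z i))\<^sup>2))"
  have gg: "(LINT x|gaussian. genfun z x * cnj (genfun z x)) = of_real ?E"
    using integral_gaussian_prod[of "\<lambda>i t. genfun1 (z i) t * cnj (genfun1 (z i) t)"]
    by (simp add: genfun_def genfun1_norm prod.distrib del: complex_mult_cnj)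
  have gh: "(LINT x|gaussian. genfun z x * cnj (hermite_sum n z x)) = of_real ?S"
    using integral_gaussian_prod[of "\<lambda>i t. genfun1 (z i) t * cnj (hermite_sum1 n (z i) t)"]
    by (simp add: genfun_def hermite_sum_def genfun1_hermite_sum1 prod.distrib)
  have hh: "(LINT x|gaussian. hermite_sum n z x * cnj (hermite_sum n z x)) = of_real ?S"
    using integral_gaussian_prod[of "\<lambda>i t. hermite_sum1 n (z i) t * cnj (hermite_sum1 n (z i) t)"]
    by (simp add: hermite_sum_def hermite_sum1_norm prod.distrib del: complex_mult_cnj)
  have hg: "(LINT x|gaussian. hermite_sum n z x * cnj (genfun z x)) = of_real ?S"
  proof -
    have "(LINT x|gaussian. hermite_sum n z x * cnj (genfun z x))
        = (LINT x|gaussian. cnj (genfun z x * cnj (hermite_sum n z x)))"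
      by (simp add: mult.commute)
    also have "\<dots> = cnj (of_real ?S)"
      unfolding Bochner_Integration.integral_cnj gh ..
    finally show ?thesis by simp
  qed
  have i: "integrable gaussian (\<lambda>x. genfun z x * cnj (genfun z x))"
      "integrable gaussian (\<lambda>x. genfun z x * cnj (hermite_sum n z x))"
     "integrable gaussian (\<lambda>x. hermite_sum n z x * cnj (genfun z x))"
         "integrable gaussian (\<lambda>x. hermite_sum n z x * cnj (hermite_sum n z x))"
    by (intro L2_mult_integrable L2_cnj genfun_L2 hermite_sum_L2)+
  have eq: "(genfun z x - hermite_sum n z x) * cnj (genfun z x - hermite_sum n z x)
      = genfun z x * cnj (genfun z x) - genfun z x * cnj (hermite_sum n z x)
      - (hermite_sum n z x * cnj (genfun z x) - hermite_sum n z x * cnj (hermite_sum n z x))" for x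
    by (simp add: algebra_simps del: complex_mult_cnj)
  have "complex_of_real (LINT x|gaussian. (cmod (genfun z x - hermite_sum n z x))\<^sup>2)
     = (LINT x|gaussian. (genfun z x - hermite_sum n z x) * cnj (genfun z x - hermite_sum n z x))"
    by (simp only: integral_complex_of_real[symmetric] complex_norm_square)
  also have "\<dots> = of_real (?E - ?S)"
    unfolding eq
    by (simp only: Bochner_Integration.integral_diff Bochner_Integration.integrable_diff i gg gh
        hg hh) simp
  finally show ?thesis by (simp only: of_real_eq_iff)
qed

lemma integral_hermite_sum_tendsto:
  assumes "f \<in> L2 gaussian"
  shows "(\<lambda>n. LINT x|gaussian. f x * hermite_sum n z x) \<longlonglongrightarrow> (LINT x|gaussian. f x * genfun z x)"
proof (rule L2_tendsto_integral_mult[OF assms genfun_L2 hermite_sum_L2])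
  have "(\<lambda>n. (\<Prod>i\<in>UNIV. exp ((cmod (z i))\<^sup>2)) - (\<Prod>i\<in>UNIV. exp_partial_sum n ((cmod (z i))\<^sup>2)))
    \<longlonglongrightarrow> (\<Prod>i\<in>UNIV. exp ((cmod (z i))\<^sup>2)) - (\<Prod>i\<in>UNIV. exp ((cmod (z i))\<^sup>2))"
    by (intro tendsto_intros exp_partial_sum_tendsto)
  then show "(\<lambda>n. LINT x|gaussian. (cmod (genfun z x - hermite_sum n z x))\<^sup>2) \<longlonglongrightarrow> 0"
    by (simp add: genfun_hermite_sum_dist)
qed

definition multi_power :: "('d \<Rightarrow> complex) \<Rightarrow> ('d::finite \<Rightarrow> nat) \<Rightarrow> complex" where
  "multi_power z \<alpha> = (\<Prod>i\<in>UNIV. z i ^ \<alpha> i)"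

definition multi_fact :: "('d::finite \<Rightarrow> nat) \<Rightarrow> complex" where
  "multi_fact \<alpha> = (\<Prod>i\<in>UNIV. fact (\<alpha> i))"

definition multi_cube :: "nat \<Rightarrow> ('d::finite \<Rightarrow> nat) set" where
  "multi_cube n = {\<alpha>. \<forall>i. \<alpha> i \<le> n}"

lemma multi_cube_PiE: "multi_cube n = PiE UNIV (\<lambda>_. {..n})"
  by (auto simp: multi_cube_def PiE_UNIV_domain)

lemma finite_multi_cube: "finite (multi_cube n)"
  unfolding multi_cube_PiE by (intro finite_PiE) auto

text \<open>The cubes exhaust all multi-indices, so the unconditional limit that defines the
functional calculus may be taken along them. On cubes the sum over multi-indices factors
into one-dimensional sums.\<close>

lemma filterlim_multi_cube: "filterlim multi_cube (finite_subsets_at_top UNIV) sequentially"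
  unfolding filterlim_finite_subsets_at_top
proof (intro allI impI)
  fix X :: "('a \<Rightarrow> nat) set" assume X: "finite X \<and> X \<subseteq> UNIV"
  define m where "m = Max (insert 0 ((\<lambda>(\<alpha>, i). \<alpha> i) ` (X \<times> UNIV)))"
  have "\<alpha> i \<le> m" if "\<alpha> \<in> X" for \<alpha> i
    unfolding m_def using X that by (intro Max_ge) (auto intro!: finite_imageI rev_image_eqI[of
        "(\<alpha>, i)"])
  then show "\<forall>\<^sub>F n in sequentially. finite (multi_cube n) \<and> X \<subseteq> multi_cube n \<and> multi_cube n \<subseteq> UNIV"
    unfolding eventually_sequentially
    by (intro exI[of _ m]) (auto simp: finite_multi_cube, auto simp: multi_cube_def
        intro: order_trans)
qed

lemma hermite_complex_prod: "hermite \<alpha> x = (\<Prod>i\<in>UNIV. complex_of_real (poly (hermite_poly (\<alpha> i))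
    (x $ i)))"
  by (simp add: hermite_def)

lemma hermite_sum_eq: "hermite_sum n z x = (\<Sum>\<alpha>\<in>multi_cube n. multi_power z \<alpha> / multi_fact \<alpha>
    * hermite \<alpha> x)"
  unfolding hermite_sum_def hermite_sum1_def multi_cube_PiE
  by (subst prod_sum_PiE) (auto simp: multi_power_def multi_fact_def hermite_complex_prod
      prod.distrib prod_dividef)

lemma hermite_measurable [measurable]: "hermite \<alpha> \<in> borel_measurable borel"
  unfolding hermite_def by measurable

lemma cnj_hermite [simp]: "cnj (hermite \<alpha> x) = hermite \<alpha> x"
  by (simp add: hermite_def)

lemma hermite_L2: "hermite \<alpha> \<in> L2 gaussian"
proof (rule L2_if_integrable_cnj)
  show "integrable gaussian (\<lambda>x. hermite \<alpha> x * cnj (hermite \<alpha> x))"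
    using integrable_gaussian_prod[where f = "\<lambda>i t. complex_of_real (poly (hermite_poly (\<alpha> i)) t)
        * of_real (poly (hermite_poly (\<alpha> i)) t)"]
      hermite_orthogonal_complex(1)
    by (simp add: hermite_complex_prod prod.distrib)
qed simp

lemma hermite_norm: "L2_inner gaussian (hermite \<alpha>) (hermite \<alpha>) = multi_fact \<alpha>"
  using integral_gaussian_prod[where f = "\<lambda>i t. complex_of_real (poly (hermite_poly (\<alpha> i)) t)
      * of_real (poly (hermite_poly (\<alpha> i)) t)"]
      hermite_orthogonal_complex
  by (simp add: L2_inner_def hermite_complex_prod prod.distrib multi_fact_def)

lemma hermite_genfun: "(LINT x|gaussian. hermite \<alpha> x * genfun z x) = multi_power z \<alpha>"
  using integral_gaussian_prod[where f = "\<lambda>i t. complex_of_real (poly (hermite_poly (\<alpha> i)) t)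
      * genfun1 (z i) t"]
  by (simp add: hermite_genfun1 hermite_complex_prod prod.distrib genfun_def multi_power_def)

text \<open>Both sides are limits over cubes. Pairing the partial sums of the series for \<open>\<psi>\<close> with
the generating function at \<open>z\<close> gives the same numbers as pairing \<open>\<phi>\<close> with the partial sums
of the generating function at the rotated point, because the factor \<open>exp (- i s |\<alpha>|)\<close> is
absorbed by the power of \<open>z\<close>.\<close>

lemma ou_group_bargmann:
  assumes "ou_group s \<phi> \<psi>"
  shows "(LINT x|gaussian. \<psi> x * genfun z x) = (LINT x|gaussian. \<phi> x * genfun
      (\<lambda>i. exp (- (\<i> * of_real s)) * z i) x)"
proof -
  define F where "F = (\<lambda>r. exp (\<i> * complex_of_real s * of_real r))"
  define c where "c \<alpha> = F (- real (multi_degree \<alpha>)) *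
        (L2_inner gaussian \<phi> (hermite \<alpha>) / L2_inner gaussian (hermite \<alpha>) (hermite \<alpha>))" for \<alpha>
  define S where "S = (\<lambda>n x. \<Sum>\<alpha>\<in>multi_cube n. c \<alpha> * hermite \<alpha> x)"
  let ?z = "\<lambda>i. exp (- (\<i> * of_real s)) * z i"
  from assms have \<phi>: "\<phi> \<in> L2 gaussian" and \<psi>: "\<psi> \<in> L2 gaussian"
    and lim: "((\<lambda>A. \<integral>\<^sup>+x. ennreal ((cmod (\<psi> x - (\<Sum>\<alpha>\<in>A. c \<alpha> * hermite \<alpha> x)))\<^sup>2) \<partial>gaussian)
        \<longlongrightarrow> 0) (finite_subsets_at_top UNIV)"
    unfolding ou_group_def ou_calculus_def c_def F_def by auto
  have S: "S n \<in> L2 gaussian" for n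
    unfolding S_def by (intro L2_sum L2_cmult hermite_L2)
  have "(\<lambda>n. \<integral>\<^sup>+x. ennreal ((cmod (\<psi> x - S n x))\<^sup>2) \<partial>gaussian) \<longlonglongrightarrow> 0"
    using filterlim_compose[OF lim filterlim_multi_cube] by (simp add: S_def)
  moreover have "(\<integral>\<^sup>+x. ennreal ((cmod (\<psi> x - S n x))\<^sup>2) \<partial>gaussian)
      = ennreal (LINT x|gaussian. (cmod (\<psi> x - S n x))\<^sup>2)" for n
    using L2_D(2)[OF L2_diff[OF \<psi> S]] by (intro nn_integral_eq_integral) auto
  ultimately have "(\<lambda>n. LINT x|gaussian. (cmod (\<psi> x - S n x))\<^sup>2) \<longlonglongrightarrow> 0"
    by (simp add: tendsto_ennreal_iff flip: ennreal_0)
  then have "(\<lambda>n. LINT x|gaussian. genfun z x * S n x) \<longlonglongrightarrow> (LINT x|gaussian. genfun z x * \<psi> x)"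
    by (rule L2_tendsto_integral_mult[OF genfun_L2 \<psi> S])
  moreover have "(LINT x|gaussian. genfun z x * S n x)
      = (LINT x|gaussian. \<phi> x * hermite_sum n ?z x)" for n
  proof -
    have "(LINT x|gaussian. genfun z x * S n x)
        = (LINT x|gaussian. (\<Sum>\<alpha>\<in>multi_cube n. c \<alpha> * (hermite \<alpha> x * genfun z x)))"
      by (simp add: S_def sum_distrib_left mult_ac)
    also have "\<dots> = (\<Sum>\<alpha>\<in>multi_cube n. c \<alpha> * multi_power z \<alpha>)"
      by (subst Bochner_Integration.integral_sum)
         (auto intro!: integrable_mult_right L2_mult_integrable hermite_L2 genfun_L2
             simp: hermite_genfun)
    also have "\<dots> = (\<Sum>\<alpha>\<in>multi_cube n. multi_power ?z \<alpha> / multi_fact \<alpha> * (LINT x|gaussian. \<phi> x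
        * hermite \<alpha> x))"
    proof (intro sum.cong refl)
      fix \<alpha> :: "'a \<Rightarrow> nat"
      have "F (- real (multi_degree \<alpha>)) = exp (- (\<i> * of_real s)) ^ multi_degree \<alpha>"
        by (simp add: F_def exp_of_nat_mult[symmetric] mult_ac)
      then have "multi_power ?z \<alpha> = F (- real (multi_degree \<alpha>)) * multi_power z \<alpha>"
        by (simp add: multi_power_def power_mult_distrib prod.distrib multi_degree_def power_sum)
      then show "c \<alpha> * multi_power z \<alpha> = multi_power ?z \<alpha> / multi_fact \<alpha> * (LINT x|gaussian. \<phi> x
          * hermite \<alpha> x)"
        by (simp add: c_def hermite_norm L2_inner_def[of _ \<phi>])
    qed
    also have "\<dots> = (LINT x|gaussian. (\<Sum>\<alpha>\<in>multi_cube n. multi_power ?z \<alpha> / multi_fact \<alpha>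
        * (\<phi> x * hermite \<alpha> x)))"
      by (subst Bochner_Integration.integral_sum)
         (auto intro!: integrable_mult_right L2_mult_integrable hermite_L2 \<phi>)
    also have "\<dots> = (LINT x|gaussian. \<phi> x * hermite_sum n ?z x)"
      by (simp add: hermite_sum_eq sum_distrib_left mult_ac)
    finally show ?thesis .
  qed
  ultimately have "(\<lambda>n. LINT x|gaussian. \<phi> x * hermite_sum n ?z x)
      \<longlonglongrightarrow> (LINT x|gaussian. genfun z x * \<psi> x)"
    by simp
  from LIMSEQ_unique[OF this integral_hermite_sum_tendsto[OF \<phi>]] show ?thesis
    by (simp add: mult.commute)
qed

section \<open>The Laplace transform along a real line\<close>

lemma genfun_eq_exp: "genfun z x = exp (- (\<Sum>i\<in>UNIV. (z i)\<^sup>2) / 2) * exp (\<Sum>i\<in>UNIV. z i * of_real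
    (x $ i))"
  by (simp add: genfun_def genfun1_def exp_sum[symmetric] exp_add[symmetric] sum_subtractf
      sum_divide_distrib)

text \<open>Up to the factor \<open>exp (- \<zeta>\<^sup>2 / 2)\<close>, the restriction of the Bargmann transform to the
complex line through \<open>\<omega>\<close> (see \<open>genfun_line\<close>).\<close>

definition laplace :: "(real ^ 'd \<Rightarrow> complex) \<Rightarrow> real ^ 'd \<Rightarrow> complex \<Rightarrow> complex" where
  "laplace f \<omega> \<zeta> = (LINT x|gaussian. f x * exp (\<zeta> * of_real (x \<bullet> \<omega>)))"

lemma sum_line: "(\<Sum>i\<in>UNIV. \<zeta> * complex_of_real (\<omega> $ i) * of_real (x $ i)) = \<zeta> * of_real (x \<bullet> \<omega>)"
  by (simp add: inner_vec_def sum_distrib_left mult_ac)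

lemma exp_inner_L2: "(\<lambda>x. exp (\<zeta> * complex_of_real (x \<bullet> \<omega>))) \<in> L2 gaussian"
proof -
  let ?z = "\<lambda>i. \<zeta> * complex_of_real (\<omega> $ i)"
  have "(\<lambda>x. exp (\<zeta> * complex_of_real (x \<bullet> \<omega>))) = (\<lambda>x. exp ((\<Sum>i\<in>UNIV. (?z i)\<^sup>2) / 2) * genfun ?z x)"
    unfolding genfun_eq_exp sum_line by (simp add: mult.assoc[symmetric] exp_add[symmetric])
  then show ?thesis using L2_cmult[OF genfun_L2, of _ ?z] by simp
qed

lemma genfun_line:
  assumes "norm \<omega> = 1"
  shows "genfun (\<lambda>i. \<zeta> * complex_of_real (\<omega> $ i)) x = exp (- (\<zeta>\<^sup>2 / 2)) * exp (\<zeta> * of_real (x \<bullet> \<omega>))"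
proof -
  have "(\<Sum>i\<in>UNIV. (\<zeta> * complex_of_real (\<omega> $ i))\<^sup>2) = \<zeta>\<^sup>2 * of_real ((norm \<omega>)\<^sup>2)"
    by (simp add: norm_vec_square power_mult_distrib sum_distrib_left)
  then show ?thesis unfolding genfun_eq_exp sum_line using assms by simp
qed

lemma laplace_ou_group:
  assumes "ou_group s \<phi> \<psi>" "norm \<omega> = 1"
  shows "exp (- (\<zeta>\<^sup>2 / 2)) * laplace \<psi> \<omega> \<zeta>
    = exp (- ((exp (- (\<i> * of_real s)) * \<zeta>)\<^sup>2 / 2)) * laplace \<phi> \<omega> (exp (- (\<i> * of_real s)) * \<zeta>)"
proof -
  have *: "exp (- (\<zeta>\<^sup>2 / 2)) * laplace f \<omega> \<zeta> = (LINT x|gaussian. f x * genfun (\<lambda>i. \<zeta> * of_real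
      (\<omega> $ i)) x)" for f \<zeta>
    unfolding laplace_def genfun_line[OF assms(2)]
        by (simp add: mult_ac flip: integral_mult_right_zero)
  show ?thesis
    unfolding * ou_group_bargmann[OF assms(1)] by (simp add: mult.assoc)
qed

lemma sum_power_fact_le_exp: "0 \<le> (a::real) \<Longrightarrow> (\<Sum>n<N. a ^ n / fact n) \<le> exp a"
  using sum_le_suminf[of "\<lambda>n. a ^ n / fact n" "{..<N}"] summable_exp[of a] exp_converges[of a]
  by (simp add: divide_inverse mult.commute sums_iff)

text \<open>The exponential series may be integrated term by term: its partial sums are dominated
by \<open>exp (R |x \<bullet> \<omega>|)\<close>, which is square integrable for \<open>\<gamma>\<close>. This exhibits a power series.\<close>

lemma laplace_holomorphic:
  assumes f: "f \<in> L2 gaussian"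
  shows "laplace f \<omega> holomorphic_on UNIV"
proof -
  note [measurable] = L2_D(1)[OF f]
  define a where "a n = (LINT x|gaussian. f x * of_real ((x \<bullet> \<omega>) ^ n / fact n))" for n
  have sums: "(\<lambda>n. a n * w ^ n) sums laplace f \<omega> w" for w
  proof -
    define R where "R = cmod w"
    define B where "B x = cmod (f x * exp (of_real R * of_real (x \<bullet> \<omega>)))
        + cmod (f x * exp (- of_real R * of_real (x \<bullet> \<omega>)))" for x
    have B: "integrable gaussian B"
      unfolding B_def
      by (intro Bochner_Integration.integrable_add integrable_norm L2_mult_integrable f
          exp_inner_L2)
    have bound: "(\<Sum>n<N. cmod (f x) * ((R * \<bar>x \<bullet> \<omega>\<bar>) ^ n / fact n)) \<le> B x" for N x
    proof -
      have "(\<Sum>n<N. cmod (f x) * ((R * \<bar>x \<bullet> \<omega>\<bar>) ^ n / fact n)) \<le> cmod (f x) * exp (R * \<bar>x \<bullet> \<omega>\<bar>)"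
        unfolding sum_distrib_left[symmetric]
        by (intro mult_left_mono sum_power_fact_le_exp) (auto simp: R_def)
      also have "exp (R * \<bar>x \<bullet> \<omega>\<bar>) \<le> exp (R * (x \<bullet> \<omega>)) + exp (- R * (x \<bullet> \<omega>))"
        by (cases "0 \<le> x \<bullet> \<omega>") auto
      also have "cmod (f x) * (exp (R * (x \<bullet> \<omega>)) + exp (- R * (x \<bullet> \<omega>))) = B x"
        by (simp add: B_def norm_mult ring_distribs)
      finally show ?thesis by (simp add: mult_left_mono)
    qed
    have nt: "cmod (f x * of_real ((x \<bullet> \<omega>) ^ n / fact n) * w ^ n)
        = cmod (f x) * ((R * \<bar>x \<bullet> \<omega>\<bar>) ^ n / fact n)" for x n
      by (simp add: norm_mult norm_power norm_divide R_def power_mult_distrib power_abs)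
    have i: "integrable gaussian (\<lambda>x. f x * of_real ((x \<bullet> \<omega>) ^ n / fact n) * w ^ n)" for n
    proof (rule Bochner_Integration.integrable_bound[OF B])
      have le: "cmod (f x * of_real ((x \<bullet> \<omega>) ^ n / fact n) * w ^ n) \<le> B x" for x
        unfolding nt using bound[of x "Suc n"]
          sum_nonneg[of "{..<n}" "\<lambda>n. cmod (f x) * ((R * \<bar>x \<bullet> \<omega>\<bar>) ^ n / fact n)"]
        by (simp add: R_def)
      show "AE x in gaussian. norm (f x * of_real ((x \<bullet> \<omega>) ^ n / fact n) * w ^ n) \<le> norm (B x)"
        unfolding real_norm_def by (intro AE_I2 order_trans[OF le abs_ge_self])
    qed measurable
    have "(\<lambda>N. LINT x|gaussian. (\<Sum>n<N. f x * of_real ((x \<bullet> \<omega>) ^ n / fact n) * w ^ n))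
        \<longlonglongrightarrow> laplace f \<omega> w"
      unfolding laplace_def
    proof (rule integral_dominated_convergence[OF _ _ B])
      have "(\<lambda>n. f x * of_real ((x \<bullet> \<omega>) ^ n / fact n) * w ^ n) sums
          (f x * exp (w * of_real (x \<bullet> \<omega>)))" for x
      proof -
        have "(\<lambda>n. f x * ((w * of_real (x \<bullet> \<omega>)) ^ n /\<^sub>R fact n)) sums
            (f x * exp (w * of_real (x \<bullet> \<omega>)))"
          by (intro sums_mult exp_converges)
        then show ?thesis
          by (simp add: scaleR_conv_of_real divide_inverse power_mult_distrib mult_ac)
      qed
      then show "AE x in gaussian. (\<lambda>N. \<Sum>n<N. f x * of_real ((x \<bullet> \<omega>) ^ n / fact n) * w ^ n)
          \<longlonglongrightarrow> f x * exp (w * of_real (x \<bullet> \<omega>))"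
        by (simp add: sums_def)
      show "AE x in gaussian. norm (\<Sum>n<N. f x * of_real ((x \<bullet> \<omega>) ^ n / fact n) * w ^ n) \<le> B x" for N
      proof (intro AE_I2)
        fix x
        have "norm (\<Sum>n<N. f x * of_real ((x \<bullet> \<omega>) ^ n / fact n) * w ^ n)
            \<le> (\<Sum>n<N. norm (f x * of_real ((x \<bullet> \<omega>) ^ n / fact n) * w ^ n))"
          by (rule norm_sum)
        also have "\<dots> \<le> B x" unfolding nt by (rule bound)
        finally show "norm (\<Sum>n<N. f x * of_real ((x \<bullet> \<omega>) ^ n / fact n) * w ^ n) \<le> B x" .
      qed
    qed measurable
    moreover have "(LINT x|gaussian. (\<Sum>n<N. f x * of_real ((x \<bullet> \<omega>) ^ n / fact n) * w ^ n))
        = (\<Sum>n<N. a n * w ^ n)" for N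
      unfolding Bochner_Integration.integral_sum[OF i] a_def integral_mult_left_zero ..
    ultimately show ?thesis by (simp add: sums_def)
  qed
  have "laplace f \<omega> field_differentiable at z" for z
  proof (rule holomorphic_on_imp_differentiable_at)
    show "laplace f \<omega> holomorphic_on ball 0 (cmod z + 1)"
      by (rule power_series_holomorphic[of _ _ a]) (use sums in simp)
  qed auto
  then show ?thesis by (auto simp: holomorphic_on_def intro: field_differentiable_at_within)
qed

section \<open>Growth of the Laplace transform under a Gaussian weight\<close>

lemma integrable_exp_neg_norm_square:
  assumes "0 < \<kappa>"
  shows "integrable lborel (\<lambda>x :: real ^ 'd. exp (- \<kappa> * (norm (x - m))\<^sup>2))"
    "(LINT x|(lborel :: (real ^ 'd) measure). exp (- \<kappa> * (norm (x - m))\<^sup>2))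
        = (LINT x|(lborel :: (real ^ 'd) measure). exp (- \<kappa> * (norm x)\<^sup>2))"
proof -
  have "integrable lborel (\<lambda>x::real. exp (- \<kappa> * x\<^sup>2))"
  proof -
    \<comment> \<open>The standard deviation for which the normal density is a multiple of \<open>exp (- \<kappa> x\<^sup>2)\<close>.\<close>
    define \<sigma> where "\<sigma> = 1 / sqrt (2 * \<kappa>)"
    have \<sigma>: "0 < \<sigma>" "2 * \<sigma>\<^sup>2 = 1 / \<kappa>" using assms by (auto simp: \<sigma>_def power_divide)
    have "integrable lborel (\<lambda>x. sqrt (2 * pi * \<sigma>\<^sup>2) * (normal_density 0 \<sigma> x * (x - 0) ^ 0))"
      using \<sigma> by (intro integrable_mult_right integrable_normal_moment)
    moreover have "sqrt (2 * pi * \<sigma>\<^sup>2) * (normal_density 0 \<sigma> x * (x - 0) ^ 0) = exp (- \<kappa> * x\<^sup>2)"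
        for x
      using \<sigma> by (simp add: normal_density_def real_sqrt_mult mult.commute)
    ultimately show ?thesis by (simp only:)
  qed
  then have i: "integrable lborel (\<lambda>x :: real ^ 'd. exp (- \<kappa> * (norm x)\<^sup>2))"
    using integrable_lborel_vec_prod[of "\<lambda>_::'d. \<lambda>x. exp (- \<kappa> * x\<^sup>2)"]
    by (simp add: norm_vec_square sum_distrib_left sum_negf exp_sum[symmetric] flip: sum_negf)
  let ?f = "\<lambda>x :: real ^ 'd. exp (- \<kappa> * (norm x)\<^sup>2)"
  have "integrable (distr lborel borel ((+) (- m))) ?f"
    unfolding lborel_distr_plus by (rule i)
  then show "integrable lborel (\<lambda>x :: real ^ 'd. exp (- \<kappa> * (norm (x - m))\<^sup>2))"
    by (subst (asm) integrable_distr_eq) simp_all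
  have "(LINT x|distr lborel borel ((+) (- m)). ?f x) = (LINT x|lborel. ?f x)"
    unfolding lborel_distr_plus ..
  then show "(LINT x|(lborel :: (real ^ 'd) measure). exp (- \<kappa> * (norm (x - m))\<^sup>2))
      = (LINT x|(lborel :: (real ^ 'd) measure). exp (- \<kappa> * (norm x)\<^sup>2))"
    by (subst (asm) integral_distr) simp_all
qed

lemma amgm_weighted: "0 < (l::real) \<Longrightarrow> p * q \<le> (l * p\<^sup>2 + q\<^sup>2 / l) / 2"
proof -
  assume l: "0 < l"
  have "0 \<le> (l * p - q)\<^sup>2 / l" using l by simp
  also have "\<dots> = l * p\<^sup>2 - 2 * p * q + q\<^sup>2 / l"
    using l by (simp add: field_simps power2_eq_square)
  finally show ?thesis by simp
qed

lemma norm_line_square: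
  assumes "norm \<omega> = 1"
  shows "(norm (x - t *\<^sub>R \<omega>))\<^sup>2 = (norm x)\<^sup>2 - 2 * t * (x \<bullet> \<omega>) + t\<^sup>2"
  using assms
  by (simp add: power2_norm_eq_inner inner_diff_left inner_diff_right inner_commute
      power2_eq_square[of t] norm_eq_1)

text \<open>Completing the square in the exponent of \<open>|f x| exp (u (x \<bullet> \<omega>)) d\<gamma>\<close> produces the
growth factor \<open>exp (u\<^sup>2 / (4 a + 1))\<close> and a Gaussian centred at a point \<open>m\<close> proportional to
\<open>u \<omega>\<close>. The product of the weighted function and of that Gaussian is split by the inequality
of arithmetic and geometric means, the Gaussian staying as a weight on both parts. The first
part then tends to zero as \<open>m\<close> moves to infinity, the second does not depend on \<open>m\<close>, and the
free parameter \<open>l\<close> balances them.\<close>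

lemma laplace_weighted_bound:
  fixes f :: "real ^ 'd \<Rightarrow> complex"
  assumes f: "f \<in> L2 gaussian" and a: "0 < a"
    and w: "(\<lambda>x. of_real (exp (a * (norm x)\<^sup>2)) * f x) \<in> L2 gaussian"
    and \<omega>: "norm \<omega> = 1" and l: "0 < l"
  shows "cmod (laplace f \<omega> \<zeta>) \<le> exp ((Re \<zeta>)\<^sup>2 / (4 * a + 1)) *
      ((l * (LINT x|gaussian. (exp (a * (norm x)\<^sup>2) * cmod (f x))\<^sup>2 * exp (- (a + 1 / 4)
          * (norm (x - (2 * Re \<zeta> / (4 * a + 1)) *\<^sub>R \<omega>))\<^sup>2))
       + (2 * pi) powr (- real CARD('d) / 2) * (LINT x|(lborel :: (real ^ 'd) measure).
           exp (- (a + 1 / 4) * (norm x)\<^sup>2)) / l) / 2)"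
proof -
  note [measurable] = L2_D(1)[OF f, simplified measurable_cong_sets[OF sets_gaussian refl]]
  define u where "u = Re \<zeta>"
  define \<kappa> where "\<kappa> = a + 1 / 4"
  have \<kappa>: "0 < \<kappa>" using a by (simp add: \<kappa>_def)
  define m where "m = (2 * u / (4 * a + 1)) *\<^sub>R \<omega>"
  define c where "c = (2 * pi) powr (- real CARD('d) / 2)"
  have c: "0 < c" by (simp add: c_def)
  define h where "h x = (exp (a * (norm x)\<^sup>2) * cmod (f x))\<^sup>2" for x
  define E where "E x = exp (- \<kappa> * (norm (x - m))\<^sup>2)" for x
  have gd: "gaussian_density x = c * exp (- (norm x)\<^sup>2 / 2)" for x :: "real ^ 'd"
      by (simp add: gaussian_density_def c_def)
  have hi: "integrable gaussian h"
    using L2_D(2)[OF w] by (simp add: h_def[abs_def] norm_mult)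
  have [measurable]: "h \<in> borel_measurable borel" "E \<in> borel_measurable borel"
    unfolding h_def E_def by measurable
  have "integrable gaussian (\<lambda>x. h x * E x)"
  proof (rule Bochner_Integration.integrable_bound[OF hi])
    show "AE x in gaussian. norm (h x * E x) \<le> norm (h x)"
      using \<kappa> by (intro AE_I2) (simp add: E_def abs_mult mult_left_le)
  qed simp
  then have hE: "integrable lborel (\<lambda>x. gaussian_density x * (h x * E x))"
    unfolding gaussian_eq by (subst (asm) integrable_density) auto
  have pt: "gaussian_density x * (cmod (f x) * exp (u * (x \<bullet> \<omega>)))
      \<le> exp (u\<^sup>2 / (4 * a + 1)) * ((l * (gaussian_density x * (h x * E x)) + c * E x / l) / 2)"
          for x :: "real ^ 'd"
  proof -
    define p where "p = exp (a * (norm x)\<^sup>2) * cmod (f x) * exp (- (norm x)\<^sup>2 / 4)"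
    have e1: "u * (x \<bullet> \<omega>) - (norm x)\<^sup>2 / 2 = u\<^sup>2 / (4 * a + 1) - \<kappa> * (norm (x - m))\<^sup>2 + a
        * (norm x)\<^sup>2 - (norm x)\<^sup>2 / 4"
    proof -
      define D where "D = 4 * a + 1"
      have D: "D \<noteq> 0" "\<kappa> = D / 4" "m = (2 * u / D) *\<^sub>R \<omega>"
        using a by (auto simp: D_def \<kappa>_def m_def)
      have km: "\<kappa> * (norm (x - m))\<^sup>2 = D / 4 * (norm x)\<^sup>2 - u * (x \<bullet> \<omega>) + u\<^sup>2 / D"
      proof -
        have 1: "D / 4 * (2 * (2 * u / D) * (x \<bullet> \<omega>)) = u * (x \<bullet> \<omega>)" using D(1) by simp
        have 2: "D / 4 * (2 * u / D)\<^sup>2 = u\<^sup>2 / D" using D(1) by (simp add: power2_eq_square)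
        show ?thesis
          unfolding D(2,3) norm_line_square[OF \<omega>] distrib_left right_diff_distrib 1 2 ..
      qed
      have "D / 4 * (norm x)\<^sup>2 = a * (norm x)\<^sup>2 + (norm x)\<^sup>2 / 4"
        by (simp add: D_def field_simps)
      with km show ?thesis unfolding D_def by linarith
    qed
    have e2: "exp (- (norm x)\<^sup>2 / 2) * exp (u * (x \<bullet> \<omega>))
        = exp (u\<^sup>2 / (4 * a + 1)) * E x * exp (a * (norm x)\<^sup>2) * exp (- (norm x)\<^sup>2 / 4)"
      unfolding E_def exp_add[symmetric] by (rule arg_cong[where f = exp]) (use e1 in linarith)
    have "gaussian_density x * (cmod (f x) * exp (u * (x \<bullet> \<omega>)))
        = c * cmod (f x) * (exp (- (norm x)\<^sup>2 / 2) * exp (u * (x \<bullet> \<omega>)))"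
      by (simp only: gd mult_ac)
    also have "\<dots> = exp (u\<^sup>2 / (4 * a + 1)) * (c * E x) * (p * 1)"
      unfolding e2 p_def by (simp only: mult_ac mult_1_right)
    also have "\<dots> \<le> exp (u\<^sup>2 / (4 * a + 1)) * (c * E x) * ((l * p\<^sup>2 + 1\<^sup>2 / l) / 2)"
      using c by (intro mult_left_mono amgm_weighted l) (auto simp: E_def)
    also have "p\<^sup>2 = h x * exp (- (norm x)\<^sup>2 / 2)"
      by (simp add: p_def h_def power_mult_distrib exp_double[symmetric])
    also have "exp (u\<^sup>2 / (4 * a + 1)) * (c * E x) * ((l * (h x * exp (- (norm x)\<^sup>2 / 2)) + 1\<^sup>2
        / l) / 2)
       = exp (u\<^sup>2 / (4 * a + 1)) * ((l * (gaussian_density x * (h x * E x)) + c * E x / l) / 2)"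
      by (simp add: gd ring_distribs add_divide_distrib mult_ac)
    finally show ?thesis .
  qed
  have Ei: "integrable lborel E" unfolding E_def by (rule integrable_exp_neg_norm_square[OF \<kappa>])
  have fi: "integrable gaussian (\<lambda>x. f x * exp (\<zeta> * of_real (x \<bullet> \<omega>)))"
    by (intro L2_mult_integrable f exp_inner_L2)
  have "cmod (laplace f \<omega> \<zeta>) \<le> (LINT x|gaussian. cmod (f x * exp (\<zeta> * of_real (x \<bullet> \<omega>))))"
    unfolding laplace_def by (rule integral_norm_bound)
  also have "\<dots> = (LINT x|lborel. gaussian_density x * (cmod (f x) * exp (u * (x \<bullet> \<omega>))))"
    unfolding gaussian_eq by (subst integral_density) (auto simp: norm_mult u_def)
  also have "\<dots> \<le> (LINT x|lborel. exp (u\<^sup>2 / (4 * a + 1))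
      * ((l * (gaussian_density x * (h x * E x)) + c * E x / l) / 2))"
  proof (rule integral_mono)
    have "integrable lborel (\<lambda>x. gaussian_density x *\<^sub>R cmod (f x * exp (\<zeta> * of_real (x \<bullet> \<omega>))))"
      using integrable_norm[OF fi] unfolding gaussian_eq by (subst (asm) integrable_density) auto
    then show "integrable lborel (\<lambda>x. gaussian_density x * (cmod (f x) * exp (u * (x \<bullet> \<omega>))))"
      by (simp add: norm_mult u_def)
    show "integrable lborel (\<lambda>x. exp (u\<^sup>2 / (4 * a + 1))
        * ((l * (gaussian_density x * (h x * E x)) + c * E x / l) / 2))"
      by (intro integrable_mult_right Bochner_Integration.integrable_add integrable_divide hE Ei)
  qed (rule pt)
  also have "\<dots> = exp (u\<^sup>2 / (4 * a + 1)) * ((l * (LINT x|lborel. gaussian_density x * (h x * E x))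
      + c * (LINT x|lborel. E x) / l) / 2)"
    using hE Ei by (simp add: Bochner_Integration.integral_add)
  also have "(LINT x|lborel. gaussian_density x * (h x * E x)) = (LINT x|gaussian. h x * E x)"
    unfolding gaussian_eq by (subst integral_density) auto
  also have "(LINT x|lborel. E x) = (LINT x|(lborel :: (real ^ 'd) measure).
      exp (- \<kappa> * (norm x)\<^sup>2))"
    unfolding E_def by (rule integrable_exp_neg_norm_square[OF \<kappa>])
  finally show ?thesis
    unfolding h_def E_def m_def c_def u_def \<kappa>_def .
qed

text \<open>The second part sharpens the first to \<open>o(1)\<close>: as \<open>u\<close> grows, the moving Gaussian
leaves every region that carries the mass of the weighted function.\<close>

lemma laplace_gaussian_bound:
  fixes f :: "real ^ 'd \<Rightarrow> complex"
  assumes f: "f \<in> L2 gaussian" and a: "0 < a"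
    and w: "(\<lambda>x. of_real (exp (a * (norm x)\<^sup>2)) * f x) \<in> L2 gaussian"
    and \<omega>: "norm \<omega> = 1"
  shows "\<exists>C. \<forall>\<zeta>. cmod (laplace f \<omega> \<zeta>) \<le> C * exp ((Re \<zeta>)\<^sup>2 / (4 * a + 1))"
    and "\<And>\<epsilon>. 0 < \<epsilon> \<Longrightarrow> \<forall>\<^sub>F u in at_top. \<forall>\<zeta>. Re \<zeta> = u \<longrightarrow> cmod (laplace f \<omega> \<zeta>)
        \<le> \<epsilon> * exp (u\<^sup>2 / (4 * a + 1))"
proof -
  note [measurable] = L2_D(1)[OF f, simplified measurable_cong_sets[OF sets_gaussian refl]]
  define h where "h x = (exp (a * (norm x)\<^sup>2) * cmod (f x))\<^sup>2" for x
  define E where "E u x = exp (- (a + 1 / 4) * (norm (x - (2 * u / (4 * a + 1)) *\<^sub>R \<omega>))\<^sup>2)" for u x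
  define J where "J u = (LINT x|gaussian. h x * E u x)" for u
  define G where "G = (2 * pi) powr (- real CARD('d) / 2)
      * (LINT x|(lborel :: (real ^ 'd) measure). exp (- (a + 1 / 4) * (norm x)\<^sup>2))"
  have b: "cmod (laplace f \<omega> \<zeta>) \<le> exp ((Re \<zeta>)\<^sup>2 / (4 * a + 1)) * ((l * J (Re \<zeta>) + G / l) / 2)"
      if "0 < l" for \<zeta> l
    using laplace_weighted_bound[OF f a w \<omega> that] unfolding J_def G_def h_def E_def .
  have hi: "integrable gaussian h"
    using L2_D(2)[OF w] by (simp add: h_def[abs_def] norm_mult)
  have [measurable]: "h \<in> borel_measurable borel" "E u \<in> borel_measurable borel" for u
    unfolding h_def E_def by measurable
  have h0: "0 \<le> h x" for x by (simp add: h_def)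
  have E1: "0 \<le> E u x" "E u x \<le> 1" for u x using a by (auto simp: E_def intro!: mult_nonpos_nonneg)
  have hE: "h x * E u x \<le> h x" for u x using mult_left_le[OF E1(2) h0] .
  have hEi: "integrable gaussian (\<lambda>x. h x * E u x)" for u
    by (rule Bochner_Integration.integrable_bound[OF hi])
       (use h0 E1 hE in \<open>auto simp: abs_mult abs_of_nonneg\<close>)
  have J: "J u \<le> (LINT x|gaussian. h x)" for u
    unfolding J_def by (intro integral_mono hEi hi hE)
  show "\<exists>C. \<forall>\<zeta>. cmod (laplace f \<omega> \<zeta>) \<le> C * exp ((Re \<zeta>)\<^sup>2 / (4 * a + 1))"
  proof (intro exI allI)
    fix \<zeta>
    have "cmod (laplace f \<omega> \<zeta>) \<le> exp ((Re \<zeta>)\<^sup>2 / (4 * a + 1)) * ((J (Re \<zeta>) + G) / 2)"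
      using b[of 1 \<zeta>] by simp
    also have "\<dots> \<le> exp ((Re \<zeta>)\<^sup>2 / (4 * a + 1)) * (((LINT x|gaussian. h x) + G) / 2)"
      using J[of "Re \<zeta>"] by (intro mult_left_mono) auto
    finally show "cmod (laplace f \<omega> \<zeta>) \<le> ((LINT x|gaussian. h x) + G) / 2
        * exp ((Re \<zeta>)\<^sup>2 / (4 * a + 1))"
      by (simp add: mult.commute)
  qed
  have "((\<lambda>u. J u) \<longlongrightarrow> (LINT x|gaussian. 0 * h x)) at_top"
    unfolding J_def
  proof (rule integral_dominated_convergence_at_top[OF _ _ hi])
    show "AE x in gaussian. ((\<lambda>u. h x * E u x) \<longlongrightarrow> 0 * h x) at_top"
    proof (intro AE_I2)
      fix x :: "real ^ 'd"
      define k D n t where "k = a + 1 / 4" "D = 4 * a + 1" "n = (norm x)\<^sup>2" "t = x \<bullet> \<omega>"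
      have kD: "0 < k" "0 < D" using a by (auto simp: k_D_n_t_def)
      have "((\<lambda>u. exp (- k * (n - 2 * (2 * u / D) * t + (2 * u / D)\<^sup>2))) \<longlongrightarrow> 0) at_top"
        using kD by real_asymp
      then have "((\<lambda>u. E u x) \<longlongrightarrow> 0) at_top"
        unfolding E_def norm_line_square[OF \<omega>] k_D_n_t_def .
      then show "((\<lambda>u. h x * E u x) \<longlongrightarrow> 0 * h x) at_top"
        by (simp add: tendsto_mult_right_zero)
    qed
    show "\<forall>\<^sub>F u in at_top. AE x in gaussian. norm (h x * E u x) \<le> h x"
      using h0 E1 hE by (simp add: abs_mult abs_of_nonneg)
  qed (auto simp: measurable_cong_sets[OF sets_gaussian refl])
  then have Jlim: "(J \<longlongrightarrow> 0) at_top" by simp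
  show "\<forall>\<^sub>F u in at_top. \<forall>\<zeta>. Re \<zeta> = u \<longrightarrow> cmod (laplace f \<omega> \<zeta>) \<le> \<epsilon> * exp (u\<^sup>2 / (4 * a + 1))"
    if e: "0 < \<epsilon>" for \<epsilon>
  proof -
    \<comment> \<open>Large enough for the constant second part to stay below \<open>\<epsilon>\<close>; the first part follows as \<open>u\<close> grows.\<close>
    define l where "l = (\<bar>G\<bar> + 1) / \<epsilon>"
    have l: "0 < l" using e by (simp add: l_def)
    have "G * \<epsilon> \<le> (\<bar>G\<bar> + 1) * \<epsilon>" using e by (intro mult_right_mono) auto
    then have G: "G / l \<le> \<epsilon>" by (simp add: l_def divide_le_eq mult.commute)
    from Jlim have "\<forall>\<^sub>F u in at_top. J u < \<epsilon> / l" using e l by (intro order_tendstoD(2)) auto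
    then show ?thesis
    proof eventually_elim
      case (elim u)
      show ?case
      proof (intro allI impI)
        fix \<zeta> assume z: "Re \<zeta> = u"
        have "l * J u \<le> \<epsilon>" using elim l by (simp add: field_simps)
        with G have "(l * J u + G / l) / 2 \<le> \<epsilon>" by simp
        then have "exp (u\<^sup>2 / (4 * a + 1)) * ((l * J u + G / l) / 2) \<le> exp (u\<^sup>2 / (4 * a + 1)) * \<epsilon>"
          by (intro mult_left_mono) auto
        from order_trans[OF b[OF l, of \<zeta>, unfolded z] this]
        show "cmod (laplace f \<omega> \<zeta>) \<le> \<epsilon> * exp (u\<^sup>2 / (4 * a + 1))"
          by (simp only: mult.commute)
      qed
    qed
  qed
qed

section \<open>A theorem of Phragmen-Lindelof type\<close>

lemma sector_Re_powr_ge: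
  fixes t p :: real and W :: complex
  assumes "0 < t" "2 \<le> p" "p * arctan t < pi / 2" "0 < Re W" "\<bar>Im W\<bar> \<le> t * Re W"
  shows "cos (p * arctan t) * cmod W powr p \<le> Re (W powr of_real p)"
proof -
  have W0: "W \<noteq> 0" using assms by auto
  have "\<bar>Arg W\<bar> = \<bar>arctan (Im W / Re W)\<bar>"
    using assms by (simp add: arg_conv_arctan)
  also have "\<dots> = arctan (\<bar>Im W / Re W\<bar>)"
    by (simp add: abs_if arctan_minus[symmetric])
  also have "\<dots> \<le> arctan t"
    using assms by (intro arctan_monotone') (simp add: abs_divide divide_le_eq)
  finally have arg: "\<bar>Arg W\<bar> \<le> arctan t" .
  have "cos (p * arctan t) \<le> cos \<bar>p * Arg W\<bar>"
  proof (rule cos_monotone_0_pi_le)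
    show "\<bar>p * Arg W\<bar> \<le> p * arctan t"
      using arg assms by (simp add: abs_mult mult_left_mono)
    show "p * arctan t \<le> pi" using assms pi_gt_zero by linarith
  qed simp
  then have c: "cos (p * arctan t) \<le> cos (p * Arg W)" by simp
  have "W powr of_real p = exp (of_real p * Ln W)"
    using W0 by (simp add: powr_def)
  also have "Re \<dots> = exp (p * ln (cmod W)) * cos (p * Arg W)"
    using W0 by (simp add: Re_exp Arg_eq_Im_Ln)
  also have "exp (p * ln (cmod W)) = cmod W powr p"
    using W0 by (simp add: powr_def)
  finally show ?thesis using c by (simp add: mult.commute mult_left_mono)
qed

text \<open>The sector has half-opening below \<open>pi / 4\<close>, so some power \<open>p > 2\<close> still has positive
real part on it. Multiplying by \<open>exp (- \<epsilon> (1 + z)^p)\<close> beats the growth of order two, the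
maximum modulus principle applies on large truncated sectors, and \<open>\<epsilon>\<close> tends to zero. The
shift by one keeps the power away from its branch point.\<close>

lemma phragmen_lindelof_sector:
  fixes f :: "complex \<Rightarrow> complex" and t C K C0 :: real
  assumes hol: "f holomorphic_on UNIV"
    and growth: "\<And>z. cmod (f z) \<le> C0 * exp (K * (cmod z)\<^sup>2)"
    and t: "0 < t" "t < 1" and C: "0 < C"
    and bdry: "\<And>z. \<bar>Im z\<bar> = t * Re z \<Longrightarrow> cmod (f z) \<le> C"
    and z: "\<bar>Im z\<bar> \<le> t * Re z"
  shows "cmod (f z) \<le> C"
proof -
  have arct: "0 < arctan t" "arctan t < pi / 4"
    using t by (simp, metis arctan_less_iff arctan_one)
  define p where "p = 1 + pi / (4 * arctan t)"
  have p2: "2 < p" using arct by (simp add: p_def field_simps)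
  have pa: "p * arctan t < pi / 2"
    using arct by (simp add: p_def field_simps)
  define c where "c = cos (p * arctan t)"
  have c: "0 < c" unfolding c_def using pa p2 arct by (intro cos_gt_zero_pi) (auto
      intro: less_trans[of _ 0])
  have C0: "0 \<le> C0"
    using order_trans[OF norm_ge_zero growth[of 0]] by simp
  define D where "D = {w. \<bar>Im w\<bar> \<le> t * Re w}"
  have DRe: "0 \<le> Re w" if "w \<in> D" for w
    using that t unfolding D_def by (smt (verit) mem_Collect_eq mult_pos_neg abs_ge_zero)
  have Re_ge: "c * cmod (1 + w) powr p \<le> Re ((1 + w) powr of_real p)" if "w \<in> D" for w
    unfolding c_def
  proof (rule sector_Re_powr_ge)
    show "\<bar>Im (1 + w)\<bar> \<le> t * Re (1 + w)"
      using that t unfolding D_def by (simp add: algebra_simps)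
  qed (use t p2 pa DRe[OF that] in auto)
  have main: "cmod (f z) \<le> C * exp (\<epsilon> * Re ((1 + z) powr of_real p))" if eps: "0 < \<epsilon>" for \<epsilon>
  proof -
    define g where "g = (\<lambda>w. f w * exp (- (of_real \<epsilon> * (1 + w) powr of_real p)))"
    have gn: "cmod (g w) = cmod (f w) * exp (- (\<epsilon> * Re ((1 + w) powr of_real p)))" for w
      by (simp add: g_def norm_mult)
    have gb: "cmod (g w) \<le> cmod (f w) * exp (- (\<epsilon> * c * cmod w powr p))" if "w \<in> D" for w
    proof -
      have "cmod w \<le> cmod (1 + w)"
        using DRe[OF that] by (simp add: cmod_def power2_eq_square algebra_simps)
      then have "c * cmod w powr p \<le> c * cmod (1 + w) powr p"
        using c p2 by (intro mult_left_mono powr_mono2) auto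
      also have "\<dots> \<le> Re ((1 + w) powr of_real p)" by (rule Re_ge[OF that])
      finally show ?thesis unfolding gn
        using eps by (intro mult_left_mono) (auto simp: mult.assoc)
    qed
    have "((\<lambda>R::real. C0 * exp (K * R\<^sup>2) * exp (- (\<epsilon> * c * R powr p))) \<longlongrightarrow> 0) at_top"
    proof -
      define e where "e = \<epsilon> * c"
      have e: "0 < e" using eps c by (simp add: e_def)
      have "filterlim (\<lambda>R::real. K * R\<^sup>2 - e * R powr p) at_bot at_top"
        using p2 e by real_asymp
      then have "((\<lambda>R. C0 * exp (K * R\<^sup>2 - e * R powr p)) \<longlongrightarrow> C0 * 0) at_top"
        by (intro tendsto_mult tendsto_const filterlim_compose[OF exp_at_bot])
      then show ?thesis by (simp add: exp_diff exp_minus field_simps e_def)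
    qed
    then have "\<forall>\<^sub>F R in at_top. C0 * exp (K * R\<^sup>2) * exp (- (\<epsilon> * c * R powr p)) < C"
      using C by (rule order_tendstoD)
    then have "\<forall>\<^sub>F R in at_top. C0 * exp (K * R\<^sup>2) * exp (- (\<epsilon> * c * R powr p)) < C \<and> cmod z
        < R \<and> 0 < R"
      by (intro eventually_conj eventually_gt_at_top)
    then obtain R where R: "C0 * exp (K * R\<^sup>2) * exp (- (\<epsilon> * c * R powr p)) < C" "cmod z < R" "0
        < R"
      by (metis (no_types, lifting) eventually_happens' trivial_limit_at_top_linorder)
    define S where "S = {w. \<bar>Im w\<bar> < t * Re w \<and> cmod w < R}"
    have opS: "open S" unfolding S_def
      by (intro open_Collect_conj open_Collect_less continuous_intros)
    have "closed {w. \<bar>Im w\<bar> \<le> t * Re w \<and> cmod w \<le> R}"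
      by (intro closed_Collect_conj closed_Collect_le continuous_intros)
    moreover have "S \<subseteq> {w. \<bar>Im w\<bar> \<le> t * Re w \<and> cmod w \<le> R}" by (auto simp: S_def)
    ultimately have clS: "closure S \<subseteq> {w. \<bar>Im w\<bar> \<le> t * Re w \<and> cmod w \<le> R}"
      by (rule closure_minimal[rotated])
    have gS: "cmod (g w) \<le> C" if w: "w \<in> S" for w
    proof (rule maximum_modulus_frontier[of g S])
      have hol_on: "g holomorphic_on {w. Re w > -1}"
        unfolding g_def
        by (intro holomorphic_intros holomorphic_on_subset[OF hol])
           (auto simp: complex_nonpos_Reals_iff)
      have "closure S \<subseteq> {w. Re w > -1}"
        using clS DRe unfolding D_def by fastforce
      then show "g holomorphic_on interior S" "continuous_on (closure S) g"
        using hol_on holomorphic_on_subset holomorphic_on_imp_continuous_on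
          interior_subset closure_subset by (metis (no_types, lifting) subset_trans)+
      show "bounded S" by (rule bounded_subset[of "cball 0 R"]) (auto simp: S_def)
      show "w \<in> S" by (rule w)
    next
      fix v assume "v \<in> frontier S"
      then have v: "v \<in> D" "cmod v \<le> R" "\<bar>Im v\<bar> = t * Re v \<or> cmod v = R"
        using clS opS unfolding frontier_def interior_open[OF opS] by (auto simp: S_def D_def)
      from v(3) show "cmod (g v) \<le> C"
      proof
        assume "\<bar>Im v\<bar> = t * Re v"
        then have "cmod (f v) \<le> C" by (rule bdry)
        moreover have "exp (- (\<epsilon> * c * cmod v powr p)) \<le> 1"
          using eps c by simp
        ultimately have "cmod (f v) * exp (- (\<epsilon> * c * cmod v powr p)) \<le> C * 1"
          using C by (intro mult_mono) auto
        with gb[OF v(1)] show ?thesis by linarith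
      next
        assume r: "cmod v = R"
        have "cmod (g v) \<le> C0 * exp (K * (cmod v)\<^sup>2) * exp (- (\<epsilon> * c * cmod v powr p))"
          using gb[OF v(1)] mult_right_mono[OF growth[of v]] by (smt (verit) exp_ge_zero)
        with r R show ?thesis by simp
      qed
    qed
    have "cmod (f z) \<le> C * exp (\<epsilon> * Re ((1 + z) powr of_real p))"
    proof (cases "\<bar>Im z\<bar> = t * Re z")
      case True
      have "z \<in> D" using z by (simp add: D_def)
      then have "0 \<le> Re ((1 + z) powr of_real p)"
        using Re_ge c by (meson mult_nonneg_nonneg order_trans less_imp_le powr_ge_zero)
      then have "C * 1 \<le> C * exp (\<epsilon> * Re ((1 + z) powr of_real p))"
        using C eps by (intro mult_left_mono) auto
      with bdry[OF True] show ?thesis by simp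
    next
      case False
      then have "z \<in> S" using z R by (simp add: S_def)
      then have "cmod (f z) * exp (- (\<epsilon> * Re ((1 + z) powr of_real p))) \<le> C"
        using gS[of z] by (simp add: gn)
      then show ?thesis by (simp add: exp_minus field_simps)
    qed
    then show ?thesis .
  qed
  have "((\<lambda>\<epsilon>. C * exp (\<epsilon> * Re ((1 + z) powr of_real p)))
      \<longlongrightarrow> C * exp (0 * Re ((1 + z) powr of_real p))) (at_right 0)"
    by (intro tendsto_intros)
  moreover have "\<forall>\<^sub>F \<epsilon> in at_right (0::real). cmod (f z)
      \<le> C * exp (\<epsilon> * Re ((1 + z) powr of_real p))"
    using main by (auto simp: eventually_at_filter)
  ultimately have "cmod (f z) \<le> C * exp (0 * Re ((1 + z) powr of_real p))"
    by (intro tendsto_lowerbound[of _ _ "at_right (0::real)"]) auto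
  then show ?thesis by simp
qed

text \<open>A quadrant is the critical opening for order two, so the sector theorem does not
apply directly. After rotating the quadrant to \<open>|Im w| < Re w\<close>, the factor \<open>exp (- \<epsilon> w\<^sup>2)\<close>
compensates the growth allowed on the rays of a slightly smaller sector; that growth is
small because these rays are close to the axes, on which one of the two bounds is constant.\<close>

lemma phragmen_lindelof_quadrant:
  fixes f :: "complex \<Rightarrow> complex"
  assumes hol: "f holomorphic_on UNIV" and C: "0 < C" and k: "0 < k"
    and re: "\<And>z. cmod (f z) \<le> C * exp (k * (Re z)\<^sup>2)"
    and im: "\<And>z. cmod (f z) \<le> C * exp (k * (Im z)\<^sup>2)"
    and z: "0 < Re z" "0 < Im z"
  shows "cmod (f z) \<le> C"
proof -
  define \<rho> where "\<rho> = Complex (1 / sqrt 2) (1 / sqrt 2)"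
  have rr: "Re (\<rho> * w) = (Re w - Im w) / sqrt 2" "Im (\<rho> * w) = (Re w + Im w) / sqrt 2" for w
    by (simp_all add: \<rho>_def diff_divide_distrib add_divide_distrib)
  define w where "w = Complex ((Re z + Im z) / sqrt 2) ((Im z - Re z) / sqrt 2)"
  have zw: "\<rho> * w = z"
    by (rule complex_eqI) (simp_all only: rr w_def complex.sel, simp_all add: field_simps)
  have w: "\<bar>Im w\<bar> < Re w"
    using z by (simp add: w_def abs_less_iff field_simps)
  have main: "cmod (f z) \<le> C * exp (\<epsilon> * Re (w\<^sup>2))" if eps: "0 < \<epsilon>" for \<epsilon>
  proof -
    define g where "g = (\<lambda>v. f (\<rho> * v) * exp (- (of_real \<epsilon> * v\<^sup>2)))"
    \<comment> \<open>Close enough to one for the sector to contain \<open>w\<close> and for \<open>\<epsilon>\<close> to dominate on its rays.\<close>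
    define t where "t = max (max (\<bar>Im w\<bar> / Re w) (1 - 2 * \<epsilon> / k)) (1 / 2)"
    have t: "0 < t" "t < 1" "\<bar>Im w\<bar> \<le> t * Re w" "k * (1 - t) \<le> 2 * \<epsilon>"
    proof -
      show "0 < t" "t < 1" using w eps k by (auto simp: t_def)
      have "\<bar>Im w\<bar> / Re w \<le> t" by (simp add: t_def)
      then show "\<bar>Im w\<bar> \<le> t * Re w" using w by (simp add: divide_le_eq)
      have "1 - 2 * \<epsilon> / k \<le> t" by (simp add: t_def)
      then show "k * (1 - t) \<le> 2 * \<epsilon>" using k by (simp add: field_simps)
    qed
    have gn: "cmod (g v) = cmod (f (\<rho> * v)) * exp (- (\<epsilon> * ((Re v)\<^sup>2 - (Im v)\<^sup>2)))" for v
      by (simp add: g_def norm_mult power2_eq_square)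
    have "cmod (g w) \<le> C"
    proof (rule phragmen_lindelof_sector[of g C "k + \<epsilon>" t C w])
      show "g holomorphic_on UNIV" unfolding g_def
        using holomorphic_on_compose_gen[of "\<lambda>v. \<rho> * v" UNIV f UNIV] hol
        by (auto simp: o_def intro!: holomorphic_intros)
      show "cmod (g v) \<le> C * exp ((k + \<epsilon>) * (cmod v)\<^sup>2)" for v
      proof -
        have "cmod \<rho> = 1" by (simp add: \<rho>_def cmod_def power2_eq_square)
        then have "(Re (\<rho> * v))\<^sup>2 \<le> (cmod v)\<^sup>2"
          by (metis abs_Re_le_cmod mult_1 norm_mult abs_le_square_iff abs_norm_cancel)
        moreover have "- (\<epsilon> * ((Re v)\<^sup>2 - (Im v)\<^sup>2)) \<le> \<epsilon> * (cmod v)\<^sup>2"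
          using eps by (simp add: cmod_power2 algebra_simps)
        ultimately have "k * (Re (\<rho> * v))\<^sup>2 + - (\<epsilon> * ((Re v)\<^sup>2 - (Im v)\<^sup>2)) \<le> (k + \<epsilon>) * (cmod v)\<^sup>2"
          unfolding distrib_right using k by (intro add_mono mult_left_mono) auto
        then have "C * (exp (k * (Re (\<rho> * v))\<^sup>2) * exp (- (\<epsilon> * ((Re v)\<^sup>2 - (Im v)\<^sup>2))))
            \<le> C * exp ((k + \<epsilon>) * (cmod v)\<^sup>2)"
          using C by (simp only: exp_add[symmetric]) (simp add: mult_left_mono)
        moreover have "cmod (g v) \<le> C * exp (k * (Re (\<rho> * v))\<^sup>2)
            * exp (- (\<epsilon> * ((Re v)\<^sup>2 - (Im v)\<^sup>2)))"
          unfolding gn by (intro mult_right_mono re) simp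
        ultimately show ?thesis by (simp add: mult.assoc)
      qed
      show "cmod (g v) \<le> C" if v: "\<bar>Im v\<bar> = t * Re v" for v
      proof -
        have x: "(Im v)\<^sup>2 = t\<^sup>2 * (Re v)\<^sup>2"
          by (metis v power2_abs power_mult_distrib)
        have "cmod (f (\<rho> * v)) \<le> C * exp (k * ((1 - t)\<^sup>2 * (Re v)\<^sup>2 / 2))"
        proof (cases "0 \<le> Im v")
          case True
          then have "(Re (\<rho> * v))\<^sup>2 = (1 - t)\<^sup>2 * (Re v)\<^sup>2 / 2"
            unfolding rr using v by (simp add: power_divide power2_eq_square algebra_simps)
          with re[of "\<rho> * v"] show ?thesis by (simp only:)
        next
          case False
          then have "Im v = - (t * Re v)" using v by simp
          then have "(Im (\<rho> * v))\<^sup>2 = (1 - t)\<^sup>2 * (Re v)\<^sup>2 / 2"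
            unfolding rr by (simp add: power_divide power2_eq_square algebra_simps)
          with im[of "\<rho> * v"] show ?thesis by (simp only:)
        qed
        then have "cmod (g v) \<le> C * exp (k * ((1 - t)\<^sup>2 * (Re v)\<^sup>2 / 2))
            * exp (- (\<epsilon> * ((Re v)\<^sup>2 - (Im v)\<^sup>2)))"
          unfolding gn by (intro mult_right_mono) auto
        also have "\<dots> = C * exp ((1 - t) * (Re v)\<^sup>2 / 2 * (k * (1 - t) - 2 * \<epsilon> * (1 + t)))"
          unfolding x mult.assoc exp_add[symmetric]
          by (simp add: power2_eq_square algebra_simps diff_divide_distrib add_divide_distrib)
        also have "\<dots> \<le> C * 1"
        proof (intro mult_left_mono)
          have "2 * \<epsilon> \<le> 2 * \<epsilon> * (1 + t)" using eps t by simp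
          then have "k * (1 - t) - 2 * \<epsilon> * (1 + t) \<le> 0" using t by linarith
          then show "exp ((1 - t) * (Re v)\<^sup>2 / 2 * (k * (1 - t) - 2 * \<epsilon> * (1 + t))) \<le> 1"
            using t by (simp add: mult_nonneg_nonpos)
        qed (use C in simp)
        finally show ?thesis by simp
      qed
    qed (use t C in auto)
    then show ?thesis unfolding gn zw
      by (simp add: exp_minus field_simps power2_eq_square exp_diff)
  qed
  have "((\<lambda>\<epsilon>. C * exp (\<epsilon> * Re (w\<^sup>2))) \<longlongrightarrow> C * exp (0 * Re (w\<^sup>2))) (at_right 0)"
    by (intro tendsto_intros)
  moreover have "\<forall>\<^sub>F \<epsilon> in at_right (0::real). cmod (f z) \<le> C * exp (\<epsilon> * Re (w\<^sup>2))"
    using main by (auto simp: eventually_at_filter)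
  ultimately have "cmod (f z) \<le> C * exp (0 * Re (w\<^sup>2))"
    by (intro tendsto_lowerbound[of _ _ "at_right (0::real)"]) auto
  then show ?thesis by simp
qed

text \<open>The two hypotheses are interchanged by a quarter turn, so the quadrant estimate holds
in all four quadrants with the same constant, and Liouville's theorem finishes.\<close>

lemma entire_gaussian_bounds_imp_constant:
  fixes f :: "complex \<Rightarrow> complex"
  assumes hol: "f holomorphic_on UNIV" and k: "0 < k"
    and re: "\<And>z. cmod (f z) \<le> C * exp (k * (Re z)\<^sup>2)"
    and im: "\<And>z. cmod (f z) \<le> C' * exp (k' * (Im z)\<^sup>2)"
  shows "f constant_on UNIV"
proof -
  define B where "B = max 1 (max C C')"
  define l where "l = max k k'"
  have B: "0 < B" "C \<le> B" "C' \<le> B" and l: "0 < l" "k \<le> l" "k' \<le> l"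
    using k by (auto simp: B_def l_def)
  have re': "cmod (f z) \<le> B * exp (l * (Re z)\<^sup>2)" for z
    using re[of z] mult_mono[of C B "exp (k * (Re z)\<^sup>2)" "exp (l * (Re z)\<^sup>2)"] B l
    by (simp add: mult_right_mono)
  have im': "cmod (f z) \<le> B * exp (l * (Im z)\<^sup>2)" for z
    using im[of z] mult_mono[of C' B "exp (k' * (Im z)\<^sup>2)" "exp (l * (Im z)\<^sup>2)"] B l
    by (simp add: mult_right_mono)
  have rot: "cmod (f (c * z)) \<le> B" if c: "c \<in> {1, \<i>, -1, -\<i>}" and z: "0 < Re z" "0 < Im z" for c z
  proof (rule phragmen_lindelof_quadrant[of "\<lambda>v. f (c * v)" B l z])
    show "(\<lambda>v. f (c * v)) holomorphic_on UNIV"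
      using holomorphic_on_compose_gen[of "\<lambda>v. c * v" UNIV f UNIV] hol
      by (auto simp: o_def intro!: holomorphic_intros)
    show "cmod (f (c * v)) \<le> B * exp (l * (Re v)\<^sup>2)" for v
      using c re'[of "c * v"] im'[of "c * v"] by auto
    show "cmod (f (c * v)) \<le> B * exp (l * (Im v)\<^sup>2)" for v
      using c re'[of "c * v"] im'[of "c * v"] by auto
  qed (use B l z in auto)
  have "cmod (f z) \<le> B" for z
  proof -
    consider "Re z = 0" | "Im z = 0" | "0 < Re z" "0 < Im z" | "Re z < 0" "0 < Im z"
      | "Re z < 0" "Im z < 0" | "0 < Re z" "Im z < 0" by linarith
    then show ?thesis
    proof cases
      case 1 then show ?thesis using re'[of z] by simp
    next
      case 2 then show ?thesis using im'[of z] by simp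
    next
      case 3 then show ?thesis using rot[of 1 z] by simp
    next
      case 4 then show ?thesis using rot[of \<i> "- \<i> * z"] by simp
    next
      case 5 then show ?thesis using rot[of "-1" "- z"] by simp
    next
      case 6 then show ?thesis using rot[of "- \<i>" "\<i> * z"] by simp
    qed
  qed
  then show ?thesis
    by (intro Liouville_theorem hol) (auto simp: bounded_iff)
qed

section \<open>Uniqueness for the Fourier transform\<close>

lemma char_gaussian:
  "(LINT v|(gaussian :: (real ^ 'd) measure). exp (\<i> * of_real (y \<bullet> v)))
      = of_real (exp (- (norm (y :: real ^ 'd))\<^sup>2 / 2))"
proof -
  have i: "integrable std_normal_distribution (\<lambda>t. exp (\<i> * of_real (y $ i) * complex_of_real t))"
      for i
    using integrable_normal_poly_exp[of 1 "\<i> * of_real (y $ i)"] by simp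
  have eq: "exp (\<i> * of_real (y \<bullet> v)) = (\<Prod>i\<in>UNIV. exp (\<i> * of_real (y $ i) * complex_of_real (v $
      i)))" for v :: "real ^ 'd"
    by (simp add: inner_vec_def sum_distrib_left exp_sum[symmetric] mult_ac)
  have "(LINT v|(gaussian :: (real ^ 'd) measure). exp (\<i> * of_real (y \<bullet> v)))
     = (\<Prod>i\<in>UNIV. exp ((\<i> * of_real (y $ i))\<^sup>2 / 2))"
    unfolding eq integral_gaussian_prod[where f
        = "\<lambda>i t. exp (\<i> * of_real (y $ i) * complex_of_real t)", OF i]
    by (simp only: integral_normal_exp)
  also have "\<dots> = exp (of_real (- (norm y)\<^sup>2 / 2))"
    by (simp add: exp_sum[symmetric] norm_vec_square power_mult_distrib sum_negf sum_divide_distrib)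
  finally show ?thesis by (simp only: exp_of_real)
qed

lemma sigma_finite_gaussian: "sigma_finite_measure (gaussian :: (real ^ 'd) measure)"
proof -
  interpret prob_space "gaussian :: (real ^ 'd) measure" by (rule prob_space_gaussian)
  show ?thesis ..
qed

text \<open>A Gaussian is a superposition of characters, again with Gaussian weights; integrating
against \<open>f\<close> and exchanging the integrals reduces to the vanishing Fourier transform.\<close>

lemma integral_gaussian_kernel_eq_0:
  fixes f :: "real ^ 'd \<Rightarrow> complex"
  assumes f: "integrable gaussian f"
    and F: "\<And>\<xi>. (LINT x|gaussian. f x * exp (\<i> * of_real (x \<bullet> \<xi>))) = 0"
  shows "(LINT x|gaussian. f x * of_real (exp (- (norm (r *\<^sub>R (x - y)))\<^sup>2 / 2))) = 0"
proof -
  interpret pair_sigma_finite "gaussian :: (real ^ 'd) measure" "gaussian :: (real ^ 'd) measure"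
    unfolding pair_sigma_finite_def by (simp add: sigma_finite_gaussian)
  interpret prob_space "gaussian :: (real ^ 'd) measure" by (rule prob_space_gaussian)
  have [measurable]: "f \<in> borel_measurable borel" using f
      by (simp add: integrable_iff_bounded cong: measurable_cong_sets)
  define g where "g x v = f x * exp (\<i> * of_real ((r *\<^sub>R (x - y)) \<bullet> v))" for x v
  have gi: "integrable (gaussian \<Otimes>\<^sub>M gaussian) (\<lambda>(x, v). g x v)"
  proof (rule Fubini_integrable)
    show "(\<lambda>(x, v). g x v) \<in> borel_measurable (gaussian \<Otimes>\<^sub>M gaussian)"
      unfolding g_def by measurable
    have n: "norm (case (x, v) of (x, v) \<Rightarrow> g x v) = norm (f x)" for x v
      by (simp add: g_def norm_mult)
    show "integrable gaussian (\<lambda>x. LINT v|gaussian. norm (case (x, v) of (x, v) \<Rightarrow> g x v))"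
      unfolding n using f by simp
    show "AE x in gaussian. integrable gaussian (\<lambda>v. case (x, v) of (x, v) \<Rightarrow> g x v)"
      unfolding g_def
      by (intro AE_I2) (auto intro!: integrable_const_bound[where B = "norm (f x)" for x]
          simp: norm_mult)
  qed
  have "(LINT x|gaussian. f x * of_real (exp (- (norm (r *\<^sub>R (x - y)))\<^sup>2 / 2)))
      = (LINT x|gaussian. LINT v|gaussian. g x v)"
    unfolding char_gaussian[symmetric] g_def by simp
  also have "\<dots> = (LINT v|gaussian. LINT x|gaussian. g x v)"
    using Fubini_integral[OF gi] by simp
  also have "\<dots> = (LINT v|gaussian. exp (- \<i> * of_real (r * (y \<bullet> v))) * (LINT x|gaussian. f x
      * exp (\<i> * of_real (x \<bullet> (r *\<^sub>R v)))))"
    by (simp add: g_def inner_diff_left ring_distribs exp_diff exp_minus divide_inverse mult_ac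
        flip: integral_mult_right_zero)
  also have "\<dots> = 0" unfolding F by simp
  finally show ?thesis .
qed

lemma lborel_integral_affine:
  fixes f :: "real ^ 'd \<Rightarrow> complex"
  assumes [measurable]: "f \<in> borel_measurable borel" and r: "r \<noteq> 0"
  shows "(LINT w|lborel. f w) = \<bar>r\<bar> ^ CARD('d) *\<^sub>R (LINT y|lborel. f (x + r *\<^sub>R y))"
proof -
  have "(LINT w|lborel. f w) = (LINT w|density (distr lborel borel (\<lambda>y. x + r *\<^sub>R y))
      (\<lambda>_. \<bar>r\<bar> ^ DIM(real ^ 'd)). f w)"
    using lborel_affine[OF r, of x] by simp
  also have "\<dots> = (LINT w|distr lborel borel (\<lambda>y. x + r *\<^sub>R y). (\<bar>r\<bar> ^ DIM(real ^ 'd)) *\<^sub>R f w)"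
    by (subst integral_density) auto
  also have "\<dots> = \<bar>r\<bar> ^ CARD('d) *\<^sub>R (LINT y|lborel. f (x + r *\<^sub>R y))"
    by (subst integral_distr) auto
  finally show ?thesis .
qed

text \<open>The smoothed indicator is a superposition of the kernels of the previous lemma, over
the points of the box.\<close>

lemma integral_smoothed_box_eq_0:
  fixes f :: "real ^ 'd \<Rightarrow> complex"
  assumes f: "integrable gaussian f"
    and F: "\<And>\<xi>. (LINT x|gaussian. f x * exp (\<i> * of_real (x \<bullet> \<xi>))) = 0"
    and r: "0 < r"
  shows "(LINT x|gaussian. f x * (LINT w|gaussian. indicator (box l u) (x + r *\<^sub>R w))) = 0"
proof -
  interpret pair_sigma_finite "gaussian :: (real ^ 'd) measure" "lborel :: (real ^ 'd) measure"
    unfolding pair_sigma_finite_def by (simp add: sigma_finite_gaussian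
        lborel.sigma_finite_measure_axioms)
  have [measurable]: "f \<in> borel_measurable borel" using f
      by (simp add: integrable_iff_bounded cong: measurable_cong_sets)
  define c where "c = (2 * pi) powr (- real CARD('d) / 2)"
  define k where "k = \<bar>1 / r\<bar> ^ CARD('d) * c"
  define e where "e x y = exp (- (norm ((1 / r) *\<^sub>R (x - y :: real ^ 'd)))\<^sup>2 / 2)" for x y
  define I where "I = (indicator (box l u) :: real ^ 'd \<Rightarrow> complex)"
  define g where "g x y = f x * (I y * of_real (k * e x y))" for x y
  have [measurable]: "I \<in> borel_measurable borel" unfolding I_def by simp
  have Ii: "integrable lborel I" 
  proof -
    have "integrable lborel (\<lambda>y. complex_of_real (indicator (box l u) y))"
      by (intro integrable_of_real integrable_real_indicator)
          (simp_all add: emeasure_bounded_finite bounded_box del: infinity_ennreal_def)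
    moreover have "(\<lambda>y. complex_of_real (indicator (box l u) y)) = I"
      by (auto simp: I_def indicator_def fun_eq_iff)
    ultimately show ?thesis by (simp only:)
  qed
  have conv: "(LINT w|gaussian. I (x + r *\<^sub>R w)) = (LINT y|lborel. I y * of_real (k * e x y))" for x
  proof -
    have "(LINT w|gaussian. I (x + r *\<^sub>R w)) = (LINT w|lborel. gaussian_density w *\<^sub>R I
        (x + r *\<^sub>R w))"
      unfolding gaussian_eq by (subst integral_density) auto
    also have "\<dots> = \<bar>1 / r\<bar> ^ CARD('d) *\<^sub>R (LINT y|lborel. gaussian_density (- (1 / r) *\<^sub>R x
        + (1 / r) *\<^sub>R y) *\<^sub>R I (x + r *\<^sub>R (- (1 / r) *\<^sub>R x + (1 / r) *\<^sub>R y)))"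
      using r by (intro lborel_integral_affine) auto
    also have "(\<lambda>y. gaussian_density (- (1 / r) *\<^sub>R x + (1 / r) *\<^sub>R y) *\<^sub>R I
        (x + r *\<^sub>R (- (1 / r) *\<^sub>R x + (1 / r) *\<^sub>R y)))
        = (\<lambda>y. c *\<^sub>R (I y * of_real (e x y)))"
    proof
      fix y
      have "x + r *\<^sub>R (- (1 / r) *\<^sub>R x + (1 / r) *\<^sub>R y) = y" using r
          by (simp add: scaleR_add_right scaleR_diff_right)
      moreover have "- (1 / r) *\<^sub>R x + (1 / r) *\<^sub>R y = - ((1 / r) *\<^sub>R (x - y))"
        by (simp add: scaleR_diff_right)
      ultimately show "gaussian_density (- (1 / r) *\<^sub>R x + (1 / r) *\<^sub>R y) *\<^sub>R I
          (x + r *\<^sub>R (- (1 / r) *\<^sub>R x + (1 / r) *\<^sub>R y)) = c *\<^sub>R (I y * of_real (e x y))"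
        by (simp only: gaussian_density_def c_def e_def norm_minus_cancel)
            (simp add: scaleR_conv_of_real mult_ac)
    qed
    finally show ?thesis
      by (simp add: k_def scaleR_conv_of_real mult_ac flip: integral_mult_right_zero)
  qed
  have gi: "integrable (gaussian \<Otimes>\<^sub>M lborel) (\<lambda>(x, y). g x y)"
  proof (rule Fubini_integrable)
    show "(\<lambda>(x, y). g x y) \<in> borel_measurable (gaussian \<Otimes>\<^sub>M lborel)"
      unfolding g_def e_def by measurable
    have k: "0 \<le> k" by (simp add: k_def c_def)
    have e1: "0 \<le> e x y" "e x y \<le> 1" for x y by (auto simp: e_def)
    have b: "norm (g x y) \<le> norm (f x) * (k * norm (I y))" for x y
      using k e1[of x y] mult_left_le[of "e x y" "norm (f x) * (k * norm (I y))"]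
      by (simp add: g_def norm_mult abs_mult mult_ac)
    have gx: "integrable lborel (\<lambda>y. g x y)" for x
    proof (rule Bochner_Integration.integrable_bound)
      show "integrable lborel (\<lambda>y. norm (f x) * (k * norm (I y)))"
        by (intro integrable_mult_right integrable_norm Ii)
      show "(\<lambda>y. g x y) \<in> borel_measurable lborel" unfolding g_def e_def by measurable
      show "AE y in lborel. norm (g x y) \<le> norm (norm (f x) * (k * norm (I y)))"
        using b k by (simp add: abs_mult)
    qed
    then show "AE x in gaussian. integrable lborel (\<lambda>y. case (x, y) of (x, y) \<Rightarrow> g x y)" by simp
    show "integrable gaussian (\<lambda>x. LINT y|lborel. norm (case (x, y) of (x, y) \<Rightarrow> g x y))"
    proof (rule Bochner_Integration.integrable_bound)
      show "integrable gaussian (\<lambda>x. norm (f x) * (LINT y|lborel. k * norm (I y)))"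
        by (intro integrable_mult_left integrable_norm f)
      show "(\<lambda>x. LINT y|lborel. norm (case (x, y) of (x, y) \<Rightarrow> g x y)) \<in> borel_measurable gaussian"
        unfolding g_def e_def by measurable
      have "(LINT y|lborel. norm (g x y)) \<le> norm (f x) * (LINT y|lborel. k * norm (I y))" for x
      proof -
        have "(LINT y|lborel. norm (g x y)) \<le> (LINT y|lborel. norm (f x) * (k * norm (I y)))"
          by (intro integral_mono integrable_norm gx integrable_mult_right Ii b)
        then show ?thesis by simp
      qed
      then show "AE x in gaussian. norm (LINT y|lborel. norm (case (x, y) of (x, y) \<Rightarrow> g x y))
          \<le> norm (norm (f x) * (LINT y|lborel. k * norm (I y)))"
        using k by (simp add: abs_mult)
    qed
  qed
  have "(LINT x|gaussian. f x * (LINT w|gaussian. I (x + r *\<^sub>R w)))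
      = (LINT x|gaussian. LINT y|lborel. g x y)"
    unfolding conv g_def by simp
  also have "\<dots> = (LINT y|lborel. LINT x|gaussian. g x y)"
    using Fubini_integral[OF gi] by simp
  also have "\<dots> = (LINT y|lborel. I y * of_real k * (LINT x|gaussian. f x * of_real (e x y)))"
    by (simp add: g_def mult_ac flip: integral_mult_right_zero)
  also have "\<dots> = 0"
    unfolding e_def integral_gaussian_kernel_eq_0[OF f F] by simp
  finally show ?thesis unfolding I_def .
qed

text \<open>As the smoothing scale \<open>1 / (n + 1)\<close> shrinks, the smoothed indicator converges to the
indicator off the boundary of the box, which is a null set.\<close>

lemma integral_box_eq_0:
  fixes f :: "real ^ 'd \<Rightarrow> complex"
  assumes f: "integrable gaussian f"
    and F: "\<And>\<xi>. (LINT x|gaussian. f x * exp (\<i> * of_real (x \<bullet> \<xi>))) = 0"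
  shows "(LINT x|gaussian. f x * indicator (box l u) x) = 0"
proof -
  interpret prob_space "gaussian :: (real ^ 'd) measure" by (rule prob_space_gaussian)
  have [measurable]: "f \<in> borel_measurable borel" using f
      by (simp add: integrable_iff_bounded cong: measurable_cong_sets)
  define I where "I = (indicator (box l u) :: real ^ 'd \<Rightarrow> complex)"
  have [measurable]: "I \<in> borel_measurable borel" unfolding I_def by simp
  have I1: "norm (I x) \<le> 1" for x by (simp add: I_def indicator_def)
  define S where "S n x = (LINT w|gaussian. I (x + (1 / real (Suc n)) *\<^sub>R w))" for n x
  have Slim: "(\<lambda>n. S n x) \<longlonglongrightarrow> I x" if x: "x \<notin> frontier (box l u)" for x
  proof -
    have "(\<lambda>n. S n x) \<longlonglongrightarrow> (LINT w|(gaussian :: (real ^ 'd) measure). I x)"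
      unfolding S_def
    proof (rule integral_dominated_convergence)
      show "integrable (gaussian :: (real ^ 'd) measure) (\<lambda>_. 1::real)" by simp
      show "AE w in gaussian. norm (I (x + (1 / real (Suc n)) *\<^sub>R w)) \<le> 1" for n
        using I1 by simp
      show "AE w in gaussian. (\<lambda>n. I (x + (1 / real (Suc n)) *\<^sub>R w)) \<longlonglongrightarrow> I x"
      proof (intro AE_I2)
        fix w :: "real ^ 'd"
        have "(\<lambda>n. x + (1 / real (Suc n)) *\<^sub>R w) \<longlonglongrightarrow> x + 0 *\<^sub>R w"
          by (intro tendsto_intros LIMSEQ_inverse_real_of_nat[unfolded inverse_eq_divide])
        then have lim: "(\<lambda>n. x + (1 / real (Suc n)) *\<^sub>R w) \<longlonglongrightarrow> x" by simp
        from x consider "x \<in> box l u" | "x \<in> - closure (box l u)"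
          by (auto simp: frontier_def interior_open[OF open_box])
        then have "\<forall>\<^sub>F n in sequentially. I (x + (1 / real (Suc n)) *\<^sub>R w) = I x"
        proof cases
          case 1
          from topological_tendstoD[OF lim open_box this] 1 show ?thesis
            by (auto simp: I_def elim: eventually_mono)
        next
          case 2
          from topological_tendstoD[OF lim _ this] have "\<forall>\<^sub>F n in sequentially. x
              + (1 / real (Suc n)) *\<^sub>R w \<notin> closure (box l u)"
            by (simp add: open_Compl)
          moreover have "I y = 0" if "y \<notin> closure (box l u)" for y
            using that closure_subset[of "box l u"] by (auto simp: I_def indicator_def)
          ultimately show ?thesis using 2 by (auto elim: eventually_mono)
        qed
        then show "(\<lambda>n. I (x + (1 / real (Suc n)) *\<^sub>R w)) \<longlonglongrightarrow> I x"
          by (rule tendsto_eventually)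
      qed
    qed (auto cong: measurable_cong_sets)
    then show ?thesis using prob_space by simp
  qed
  have "AE x in lborel. x \<notin> frontier (box l u)"
  proof (rule AE_not_in)
    have "frontier (box l u) \<in> null_sets lebesgue"
      using negligible_convex_frontier[OF convex_box(2)] by (simp add: negligible_iff_null_sets)
    then show "frontier (box l u) \<in> null_sets lborel"
      by (auto simp: null_sets_def)
  qed
  then have fr: "AE x in gaussian. x \<notin> frontier (box l u)"
    unfolding gaussian_eq by (subst AE_density) auto
  have "(\<lambda>n. LINT x|gaussian. f x * S n x) \<longlonglongrightarrow> (LINT x|gaussian. f x * I x)"
  proof (rule integral_dominated_convergence[OF _ _ integrable_norm[OF f]])
    show "AE x in gaussian. (\<lambda>n. f x * S n x) \<longlonglongrightarrow> f x * I x"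
      using fr by eventually_elim (intro tendsto_mult tendsto_const Slim)
    have "norm (S n x) \<le> 1" for n x
    proof -
      have "norm (S n x) \<le> (LINT w|gaussian. norm (I (x + (1 / real (Suc n)) *\<^sub>R w)))"
        unfolding S_def by (rule integral_norm_bound)
      also have "\<dots> \<le> (LINT w|(gaussian :: (real ^ 'd) measure). 1)"
        using I1 by (intro integral_mono integrable_const_bound[where B = 1]) auto
      finally show ?thesis using prob_space by simp
    qed
    then show "AE x in gaussian. norm (f x * S n x) \<le> norm (f x)" for n
      by (simp add: norm_mult mult_left_le)
    show "(\<lambda>x. f x * S n x) \<in> borel_measurable gaussian" for n
      unfolding S_def by measurable
  qed measurable
  moreover have "(LINT x|gaussian. f x * S n x) = 0" for n
    unfolding S_def I_def by (rule integral_smoothed_box_eq_0[OF f F]) simp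
  ultimately show ?thesis by (simp add: I_def LIMSEQ_const_iff)
qed

text \<open>Open boxes are stable under intersection and generate the Borel sets, so the integral
vanishes over every Borel set.\<close>

lemma AE_zero_if_integral_box_eq_0:
  fixes g :: "real ^ 'd \<Rightarrow> real"
  assumes g: "integrable gaussian g"
    and all: "(LINT x|gaussian. g x) = 0"
    and box: "\<And>l u. (LINT x|gaussian. g x * indicator (box l u) x) = 0"
  shows "AE x in gaussian. g x = 0"
proof (rule density_unique_real[OF g])
  show "integrable gaussian (\<lambda>x. 0::real)" by simp
  fix A :: "(real ^ 'd) set" assume "A \<in> sets gaussian"
  then have 3: "A \<in> sigma_sets UNIV (range (\<lambda>(a, b). box a b :: (real ^ 'd) set))"
    by (simp add: borel_eq_box)
  have 1: "Int_stable (range (\<lambda>(a, b). box a b :: (real ^ 'd) set))"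
    by (auto simp: Int_stable_def box_Int_box)
  have 2: "range (\<lambda>(a, b). box a b :: (real ^ 'd) set) \<subseteq> Pow UNIV" by simp
  from 1 2 3 have "(LINT x:A|gaussian. g x) = 0"
  proof (induction rule: sigma_sets_induct_disjoint)
    case (basic A)
    then show ?case using box by (auto simp: set_lebesgue_integral_def mult.commute)
  next
    case (compl A)
    then have A: "A \<in> sets gaussian" by (simp add: borel_eq_box)
    have "(LINT x:UNIV - A|gaussian. g x) = (LINT x|gaussian. g x) - (LINT x:A|gaussian. g x)"
    proof -
      have "(LINT x:UNIV - A|gaussian. g x) = (LINT x|gaussian. g x - indicator A x *\<^sub>R g x)"
        unfolding set_lebesgue_integral_def
        by (intro Bochner_Integration.integral_cong refl) (auto simp: indicator_def)
      also have "\<dots> = (LINT x|gaussian. g x) - (LINT x:A|gaussian. g x)"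
        unfolding set_lebesgue_integral_def
        by (intro Bochner_Integration.integral_diff g integrable_mult_indicator A)
      finally show ?thesis .
    qed
    then show ?case using compl all by simp
  next
    case (union A)
    then have A: "A i \<in> sets gaussian" for i by (auto simp: borel_eq_box)
    have "(LINT x:(\<Union>i. A i)|gaussian. g x) = (\<Sum>i. (LINT x:A i|gaussian. g x))"
    proof (rule lebesgue_integral_countable_add)
      have "(\<Union>i. A i) \<in> sets gaussian" using A by (intro sets.countable_UN) auto
      then show "set_integrable gaussian (\<Union>i. A i) g"
        unfolding set_integrable_def by (intro integrable_mult_indicator g)
    qed (use union(1) A in \<open>auto simp: disjoint_family_on_def\<close>)
    then show ?case using union by simp
  qed (auto simp: set_lebesgue_integral_def)
  then show "(LINT x:A|gaussian. g x) = (LINT x:A|gaussian. 0)"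
    by (simp add: set_lebesgue_integral_def)
qed

lemma fourier_gaussian_unique:
  fixes f :: "real ^ 'd \<Rightarrow> complex"
  assumes f: "integrable gaussian f"
    and F: "\<And>\<xi>. (LINT x|gaussian. f x * exp (\<i> * of_real (x \<bullet> \<xi>))) = 0"
  shows "AE x in gaussian. f x = 0"
proof -
  have i: "integrable gaussian (\<lambda>x. f x * indicator (box l u) x)" for l u
  proof (rule Bochner_Integration.integrable_bound[OF f])
    have [measurable]: "f \<in> borel_measurable borel" using f
        by (simp add: integrable_iff_bounded cong: measurable_cong_sets)
    show "(\<lambda>x. f x * indicator (box l u) x) \<in> borel_measurable gaussian" by measurable
  qed (auto simp: norm_mult indicator_def)
  have f0: "(LINT x|gaussian. f x) = 0" using F[of 0] by simp
  have "AE x in gaussian. Re (f x) = 0"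
  proof (rule AE_zero_if_integral_box_eq_0)
    show "(LINT x|gaussian. Re (f x) * indicator (box l u) x) = 0" for l u
    proof -
      have "(LINT x|gaussian. Re (f x) * indicator (box l u) x)
          = (LINT x|gaussian. Re (f x * indicator (box l u) x))"
        by (intro Bochner_Integration.integral_cong refl) (auto simp: indicator_def)
      also have "\<dots> = 0"
        unfolding integral_Re[OF i] integral_box_eq_0[OF f F] by simp
      finally show ?thesis .
    qed
  qed (use f f0 in \<open>simp_all add: integral_Re integral_Im\<close>)
  moreover have "AE x in gaussian. Im (f x) = 0"
  proof (rule AE_zero_if_integral_box_eq_0)
    show "(LINT x|gaussian. Im (f x) * indicator (box l u) x) = 0" for l u
    proof -
      have "(LINT x|gaussian. Im (f x) * indicator (box l u) x)
          = (LINT x|gaussian. Im (f x * indicator (box l u) x))"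
        by (intro Bochner_Integration.integral_cong refl) (auto simp: indicator_def)
      also have "\<dots> = 0"
        unfolding integral_Im[OF i] integral_box_eq_0[OF f F] by simp
      finally show ?thesis .
    qed
  qed (use f f0 in \<open>simp_all add: integral_Re integral_Im\<close>)
  ultimately show ?thesis by eventually_elim (simp add: complex_eq_iff)
qed

section \<open>The uncertainty principle\<close>

lemma two_Re_square: "2 * (Re z)\<^sup>2 = (cmod z)\<^sup>2 + Re (z\<^sup>2)"
  unfolding cmod_power2 by (simp add: power2_eq_square)

lemma two_Im_square: "2 * (Im z)\<^sup>2 = (cmod z)\<^sup>2 - Re (z\<^sup>2)"
  unfolding cmod_power2 by (simp add: power2_eq_square)

text \<open>The borderline case, where the two discs of the introduction touch. Here \<open>q\<close> is the
unit vector along the line of centres, \<open>w\<close> the point of contact, and \<open>\<rho>\<close>, with \<open>\<rho>\<^sup>2 = 1 /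
q\<close>, the rotation that makes this line real.\<close>

lemma laplace_eq_0:
  fixes \<phi> \<psi> :: "real ^ 'd \<Rightarrow> complex"
  assumes \<phi>: "\<phi> \<in> L2 gaussian" and ou: "ou_group s \<phi> \<psi>" and ab: "0 < a" "0 < b"
    and wa: "(\<lambda>x. of_real (exp (a * (norm x)\<^sup>2)) * \<phi> x) \<in> L2 gaussian"
    and wb: "(\<lambda>x. of_real (exp (b * (norm x)\<^sup>2)) * \<psi> x) \<in> L2 gaussian"
    and eq: "a * b * (sin s)\<^sup>2 = 1 / 16" and \<omega>: "norm \<omega> = 1"
  shows "laplace \<phi> \<omega> \<zeta> = 0"
proof -
  have \<psi>: "\<psi> \<in> L2 gaussian" using ou by (simp add: ou_group_def ou_calculus_def)
  define A B where "A = 1 / (2 * (4 * a + 1))" and "B = 1 / (2 * (4 * b + 1))"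
  have AB: "0 < A" "0 < B" "B < 1 / 2" using ab by (simp_all add: A_def B_def field_simps)
  define e where "e = exp (\<i> * complex_of_real s)"
  have e1: "cmod e = 1" by (simp add: e_def)
  define q where "q = (of_real (A - 1 / 2) - e\<^sup>2 * of_real (B - 1 / 2)) / of_real (A + B)"
  have e2: "e\<^sup>2 = Complex (cos (2 * s)) (sin (2 * s))"
    by (simp add: e_def exp_double[symmetric] complex_eq_iff Re_exp Im_exp)
  \<comment> \<open>By \<open>eq\<close>, the distance of the centres is the sum of the radii.\<close>
  have q1: "cmod q = 1"
  proof -
    have "(cmod (of_real (A - 1 / 2) - e\<^sup>2 * of_real (B - 1 / 2)))\<^sup>2
        = (A - 1 / 2)\<^sup>2 + (B - 1 / 2)\<^sup>2 * ((cos (2 * s))\<^sup>2 + (sin (2 * s))\<^sup>2) - 2 * (A - 1 / 2)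
            * (B - 1 / 2) * cos (2 * s)"
    proof -
      have ring: "(x - c * y)\<^sup>2 + (d * y)\<^sup>2 = x\<^sup>2 + y\<^sup>2 * (c\<^sup>2 + d\<^sup>2) - 2 * x * y * c"
          for x y c d :: real
        by (simp add: power2_eq_square algebra_simps)
      have "Re (of_real (A - 1 / 2) - e\<^sup>2 * of_real (B - 1 / 2)) = (A - 1 / 2) - cos (2 * s)
          * (B - 1 / 2)"
        "Im (of_real (A - 1 / 2) - e\<^sup>2 * of_real (B - 1 / 2)) = - (sin (2 * s) * (B - 1 / 2))"
        unfolding e2 by simp_all
      then show ?thesis unfolding cmod_power2 by (simp only: power2_minus ring)
    qed
    also have "(cos (2 * s))\<^sup>2 + (sin (2 * s))\<^sup>2 = 1" by simp
    also have "(A - 1 / 2)\<^sup>2 + (B - 1 / 2)\<^sup>2 * 1 - 2 * (A - 1 / 2) * (B - 1 / 2) * cos (2 * s)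
        = (A - B)\<^sup>2 + 4 * (A - 1 / 2) * (B - 1 / 2) * (sin s)\<^sup>2"
      unfolding cos_double_sin by (simp add: power2_eq_square algebra_simps)
    also have "4 * (A - 1 / 2) * (B - 1 / 2) * (sin s)\<^sup>2 = 64 * A * B * (a * b * (sin s)\<^sup>2)"
    proof -
      have "A - 1 / 2 = - 4 * a * A" "B - 1 / 2 = - 4 * b * B"
        using ab by (simp_all add: A_def B_def field_simps)
      then show ?thesis by simp
    qed
    also have "(A - B)\<^sup>2 + 64 * A * B * (a * b * (sin s)\<^sup>2) = (A + B)\<^sup>2"
      unfolding eq by (simp add: power2_eq_square algebra_simps)
    finally have "cmod (of_real (A - 1 / 2) - e\<^sup>2 * of_real (B - 1 / 2)) = \<bar>A + B\<bar>"
      by (metis abs_norm_cancel power2_eq_iff_nonneg abs_ge_zero norm_ge_zero power2_abs)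
    then show ?thesis
      unfolding q_def norm_divide norm_of_real using AB by simp
  qed
  then have q0: "q \<noteq> 0" by auto
  define \<rho> where "\<rho> = 1 / csqrt q"
  have \<rho>2: "\<rho>\<^sup>2 * q = 1" using q0 by (simp add: \<rho>_def power_divide)
  have \<rho>1: "cmod \<rho> = 1" by (simp add: \<rho>_def norm_divide norm_csqrt q1)
  \<comment> \<open>Needed below to make \<open>Re (\<rho> \<zeta>)\<close> large on the imaginary axis.\<close>
  have Im\<rho>: "Im \<rho> \<noteq> 0"
  proof
    assume "Im \<rho> = 0"
    then have "\<rho>\<^sup>2 = of_real ((cmod \<rho>)\<^sup>2)"
      using cmod_power2[of \<rho>] by (simp add: complex_eq_iff power2_eq_square)
    then have "q = 1" using \<rho>2 \<rho>1 by simp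
    then have "of_real (A - 1 / 2) - e\<^sup>2 * of_real (B - 1 / 2) = complex_of_real (A + B)"
      using AB by (simp add: q_def divide_eq_eq flip: of_real_add)
    then have "e\<^sup>2 * of_real (B - 1 / 2) = complex_of_real (- 1 / 2 - B)"
      by (simp add: algebra_simps)
    then have "cmod (e\<^sup>2 * of_real (B - 1 / 2)) = cmod (complex_of_real (- 1 / 2 - B))" by simp
    then have "\<bar>B - 1 / 2\<bar> = \<bar>- 1 / 2 - B\<bar>"
      unfolding norm_mult norm_power e1 norm_of_real by simp
    then show False using AB by simp
  qed
  define w where "w = of_real (A - 1 / 2) - of_real A * q"
  define F where "F z = exp (- (z\<^sup>2 / 2)) * laplace \<phi> \<omega> z" for z
  have F': "F z = exp (- ((e * z)\<^sup>2 / 2)) * laplace \<psi> \<omega> (e * z)" for z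
  proof -
    have inv_e: "exp (- (\<i> * of_real s)) * (e * z) = z"
      by (simp add: e_def exp_minus)
    show ?thesis
      using laplace_ou_group[OF ou \<omega>, of "e * z"] unfolding inv_e F_def by (rule sym)
  qed
  define f where "f \<zeta> = F (\<rho> * \<zeta>) * exp (- (w * (\<rho> * \<zeta>)\<^sup>2))" for \<zeta>
  have \<zeta>2: "\<zeta>\<^sup>2 = q * (\<rho> * \<zeta>)\<^sup>2" for \<zeta>
    using \<rho>2 by (simp add: power_mult_distrib mult.assoc[symmetric] mult.commute)
  have exp_minus_split: "exp (x - y) = exp x * exp (- y)" for x y :: complex
    by (simp add: exp_add[symmetric])
  have half: "1 / (2 * d) * (2 * x) = x / d" for d x :: real
    by (cases "d = 0") auto
  have f1: "cmod (f \<zeta>) = cmod (laplace \<phi> \<omega> (\<rho> * \<zeta>)) * exp (- ((Re (\<rho> * \<zeta>))\<^sup>2 / (4 * a + 1)))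
      * exp (2 * A * (Re \<zeta>)\<^sup>2)" for \<zeta>
  proof -
    define z where "z = \<rho> * \<zeta>"
    have cz: "cmod z = cmod \<zeta>" by (simp add: z_def norm_mult \<rho>1)
    have "Re (- (z\<^sup>2 / 2) - w * z\<^sup>2) = A * Re (q * z\<^sup>2) - A * Re (z\<^sup>2)"
      by (simp add: w_def algebra_simps)
    also have "\<dots> = A * (2 * (Re \<zeta>)\<^sup>2) - A * (2 * (Re z)\<^sup>2)"
      unfolding two_Re_square cz \<zeta>2[of \<zeta>, folded z_def, symmetric] by (simp add: algebra_simps)
    also have "A * (2 * (Re z)\<^sup>2) = (Re z)\<^sup>2 / (4 * a + 1)"
      unfolding A_def by (rule half)
    finally have E: "Re (- (z\<^sup>2 / 2) - w * z\<^sup>2) = - ((Re z)\<^sup>2 / (4 * a + 1)) + 2 * A * (Re \<zeta>)\<^sup>2"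
      by simp
    have "f \<zeta> = laplace \<phi> \<omega> z * exp (- (z\<^sup>2 / 2) - w * z\<^sup>2)"
      unfolding f_def F_def z_def[symmetric] exp_minus_split by (simp only: mult_ac)
    then have "cmod (f \<zeta>) = cmod (laplace \<phi> \<omega> z) * exp (Re (- (z\<^sup>2 / 2) - w * z\<^sup>2))"
      by (simp only: norm_mult norm_exp_eq_Re)
    then show ?thesis unfolding E exp_add unfolding z_def by (simp only: mult.assoc)
  qed
  have f2: "cmod (f \<zeta>) = cmod (laplace \<psi> \<omega> (e * (\<rho> * \<zeta>)))
      * exp (- ((Re (e * (\<rho> * \<zeta>)))\<^sup>2 / (4 * b + 1))) * exp (2 * B * (Im \<zeta>)\<^sup>2)" for \<zeta>
  proof -
    define z where "z = \<rho> * \<zeta>"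
    have cz: "cmod (e * z) = cmod \<zeta>" by (simp add: z_def norm_mult \<rho>1 e1)
    have qAB: "q * of_real (A + B) = of_real (A - 1 / 2) - e\<^sup>2 * of_real (B - 1 / 2)"
      unfolding q_def using AB by (simp add: flip: of_real_add)
    have "- ((e * z)\<^sup>2 / 2) - w * z\<^sup>2 = - (of_real B * (q * z\<^sup>2)) - of_real B * (e * z)\<^sup>2
        + (q * of_real (A + B) - (of_real (A - 1 / 2) - e\<^sup>2 * of_real (B - 1 / 2))) * z\<^sup>2"
      by (simp add: w_def algebra_simps power_mult_distrib)
    then have "- ((e * z)\<^sup>2 / 2) - w * z\<^sup>2 = - (of_real B * (q * z\<^sup>2)) - of_real B * (e * z)\<^sup>2"
      unfolding qAB by simp
    then have "Re (- ((e * z)\<^sup>2 / 2) - w * z\<^sup>2) = - (B * Re (q * z\<^sup>2)) - B * Re ((e * z)\<^sup>2)"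
      by (simp only: minus_complex.sel uminus_complex.sel times_complex.sel(1)[of "of_real B"]
          Re_complex_of_real Im_complex_of_real mult_zero_left diff_zero)
    also have "\<dots> = B * (2 * (Im \<zeta>)\<^sup>2) - B * (2 * (Re (e * z))\<^sup>2)"
      unfolding two_Re_square two_Im_square cz \<zeta>2[of \<zeta>, folded z_def, symmetric]
          by (simp add: algebra_simps)
    also have "B * (2 * (Re (e * z))\<^sup>2) = (Re (e * z))\<^sup>2 / (4 * b + 1)"
      unfolding B_def by (rule half)
    finally have E: "Re (- ((e * z)\<^sup>2 / 2) - w * z\<^sup>2) = - ((Re (e * z))\<^sup>2 / (4 * b + 1)) + 2 * B
        * (Im \<zeta>)\<^sup>2"
      by simp
    have "f \<zeta> = laplace \<psi> \<omega> (e * z) * exp (- ((e * z)\<^sup>2 / 2) - w * z\<^sup>2)"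
      unfolding f_def F' z_def[symmetric] exp_minus_split by (simp only: mult_ac)
    then have "cmod (f \<zeta>) = cmod (laplace \<psi> \<omega> (e * z)) * exp (Re (- ((e * z)\<^sup>2 / 2) - w * z\<^sup>2))"
      by (simp only: norm_mult norm_exp_eq_Re)
    then show ?thesis unfolding E exp_add unfolding z_def by (simp only: mult.assoc)
  qed
  obtain C where C: "\<And>z. cmod (laplace \<phi> \<omega> z) \<le> C * exp ((Re z)\<^sup>2 / (4 * a + 1))"
    using laplace_gaussian_bound(1)[OF \<phi> ab(1) wa \<omega>] by blast
  obtain C' where C': "\<And>z. cmod (laplace \<psi> \<omega> z) \<le> C' * exp ((Re z)\<^sup>2 / (4 * b + 1))"
    using laplace_gaussian_bound(1)[OF \<psi> ab(2) wb \<omega>] by blast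
  have cancel: "x * exp (- y) \<le> c" if "x \<le> c * exp y" for x y c :: real
    using that by (simp add: exp_minus field_simps)
  have "f constant_on UNIV"
  proof (rule entire_gaussian_bounds_imp_constant)
    show "f holomorphic_on UNIV"
      unfolding f_def F_def
      using holomorphic_on_compose_gen[of "\<lambda>z. \<rho> * z" UNIV
          "laplace \<phi> \<omega>" UNIV] laplace_holomorphic[OF \<phi>, of \<omega>]
      by (auto simp: o_def intro!: holomorphic_intros)
    show "0 < 2 * A" using AB by simp
    show "cmod (f z) \<le> C * exp (2 * A * (Re z)\<^sup>2)" for z
      unfolding f1 by (intro mult_right_mono cancel C) simp
    show "cmod (f z) \<le> C' * exp (2 * B * (Im z)\<^sup>2)" for z
      unfolding f2 by (intro mult_right_mono cancel C') simp
  qed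
  then obtain c where c: "\<And>z. f z = c" by (auto simp: constant_on_def)
  have "cmod c \<le> \<epsilon>" if \<epsilon>: "0 < \<epsilon>" for \<epsilon>
  proof -
    obtain u where u: "\<And>z. Re z = u \<Longrightarrow> cmod (laplace \<phi> \<omega> z) \<le> \<epsilon> * exp (u\<^sup>2 / (4 * a + 1))"
      using eventually_happens'[OF _ laplace_gaussian_bound(2)[OF \<phi> ab(1) wa \<omega> \<epsilon>]] by auto
    \<comment> \<open>A purely imaginary point: there the growing factor of \<open>f1\<close> is one.\<close>
    define \<zeta> where "\<zeta> = \<i> * of_real (- u / Im \<rho>)"
    have "Re (\<rho> * \<zeta>) = u" "Re \<zeta> = 0" using Im\<rho> by (simp_all add: \<zeta>_def)
    then show ?thesis
      using f1[of \<zeta>] cancel[OF u[of "\<rho> * \<zeta>"]] by (simp add: c)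
  qed
  then have "c = 0"
    using field_le_epsilon[of "cmod c" 0] by simp
  then have f0: "f z = 0" for z using c by simp
  have "\<rho> * (\<zeta> / \<rho>) = \<zeta>" using \<rho>1 by auto
  then show ?thesis using f0[of "\<zeta> / \<rho>"] by (simp add: f_def F_def)
qed

theorem proposition2p6:
  fixes s a b :: real and \<phi> \<psi> :: "real ^ 'd \<Rightarrow> complex"
  assumes "\<phi> \<in> L2 gaussian"
    and "ou_group s \<phi> \<psi>"
    and "a > 0" and "b > 0"
    and "(\<lambda>x. of_real (exp (a * (norm x)\<^sup>2)) * \<phi> x) \<in> L2 gaussian"
    and "(\<lambda>x. of_real (exp (b * (norm x)\<^sup>2)) * \<psi> x) \<in> L2 gaussian"
    and "a * b * (sin s)\<^sup>2 \<ge> 1 / 16"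
  shows "AE x in gaussian. \<phi> x = 0"
proof -
  have sin: "0 < (sin s)\<^sup>2" using assms(7) by (cases "sin s = 0") auto
  \<comment> \<open>The value of the exponent at which the two discs touch.\<close>
  define b' where "b' = 1 / (16 * a * (sin s)\<^sup>2)"
  have b': "0 < b'" "b' \<le> b" "a * b' * (sin s)\<^sup>2 = 1 / 16"
    using sin assms(3,7) by (auto simp: b'_def field_simps)
  have \<psi>: "\<psi> \<in> L2 gaussian" using assms(2) by (simp add: ou_group_def ou_calculus_def)
  note [measurable] = L2_D(1)[OF \<psi>, simplified measurable_cong_sets[OF sets_gaussian refl]]
  have wb: "(\<lambda>x. of_real (exp (b' * (norm x)\<^sup>2)) * \<psi> x) \<in> L2 gaussian"
  proof -
    have "integrable gaussian (\<lambda>x. (cmod (of_real (exp (b' * (norm x)\<^sup>2)) * \<psi> x))\<^sup>2)"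
    proof (rule Bochner_Integration.integrable_bound[OF L2_D(2)[OF assms(6)]])
      show "AE x in gaussian. norm ((cmod (of_real (exp (b' * (norm x)\<^sup>2)) * \<psi> x))\<^sup>2)
          \<le> norm ((cmod (of_real (exp (b * (norm x)\<^sup>2)) * \<psi> x))\<^sup>2)"
        using b'(2) by (intro AE_I2) (auto simp: norm_mult intro!: power_mono mult_right_mono)
    qed simp
    then show ?thesis by (simp add: L2_def)
  qed
  have L: "laplace \<phi> \<omega> \<zeta> = 0" if "norm \<omega> = 1" for \<omega> \<zeta>
    by (rule laplace_eq_0[OF assms(1,2,3) b'(1) assms(5) wb b'(3) that])
  show ?thesis
  proof (rule fourier_gaussian_unique)
    show "integrable gaussian \<phi>"
      using L2_mult_integrable[OF assms(1) exp_inner_L2[of 0 0]] by simp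
    fix \<xi> :: "real ^ 'd"
    show "(LINT x|gaussian. \<phi> x * exp (\<i> * of_real (x \<bullet> \<xi>))) = 0"
    proof (cases "\<xi> = 0")
      case True
      show ?thesis using L[of "axis undefined 1" 0] True by (simp add: laplace_def)
    next
      case False
      then have "\<i> * of_real (norm \<xi>) * of_real (x \<bullet> (\<xi> /\<^sub>R norm \<xi>))
          = \<i> * complex_of_real (x \<bullet> \<xi>)" for x
        by (simp add: field_simps)
      moreover have "laplace \<phi> (\<xi> /\<^sub>R norm \<xi>) (\<i> * of_real (norm \<xi>)) = 0"
        using False by (intro L) simp
      ultimately show ?thesis by (simp only: laplace_def)
    qed
  qed
qed

end
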